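(* Let $I$ be a nonempty denumerable index set, let $\{X_i, i\in I\}$ and $\{Y_i, i\in I\}$ be two mean-zero Gaussian processes such that $$E(X_i-X_j)^2 \le E(Y_i-Y_j)^2 \quad\text{for all } i,j\in I,$$ and let $\{m_i, i\in I\}$ be arbitrary real constants. Then $$E\sup_{i\in I}\{X_i+m_i\} \le E\sup_{i\in I}\{Y_i+m_i\}.$$
   Context: "Denumerable" means countable (finite or countably infinite). A mean-zero Gaussian process indexed by $I$ is a family of real random variables such that every finite linear combination is a (possibly degenerate) centered Gaussian variable. Suprema may take the value $+\infty$, and expectations are taken in $(-\infty,+\infty]$. *)

theory Defs
  imports "HOL-Probability.Probability"
begin

definition centered_gaussian :: "'a measure \<Rightarrow> ('a \<Rightarrow> real) \<Rightarrow> bool" where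
  "centered_gaussian M Z \<longleftrightarrow> Z \<in> borel_measurable M \<and>
     ((AE \<omega> in M. Z \<omega> = 0) \<or> (\<exists>\<sigma>>0. distributed M lborel Z (normal_density 0 \<sigma>)))"

definition centered_gaussian_process ::
    "'a measure \<Rightarrow> 'i set \<Rightarrow> ('i \<Rightarrow> 'a \<Rightarrow> real) \<Rightarrow> bool" where
  "centered_gaussian_process M I X \<longleftrightarrow> prob_space M \<and>
     (\<forall>F c. finite F \<and> F \<subseteq> I \<longrightarrow> centered_gaussian M (\<lambda>\<omega>. \<Sum>i\<in>F. c i * X i \<omega>))"

text \<open>The Bochner integral returns 0 on non-integrable functions, so expectations with values in
  \<open>(-\<infinity>, \<infinity>]\<close> are defined as the integral of the positive part minus the integral of the
  negative part; \<^const>\<open>e2ennreal\<close> sends negative numbers to 0. The value is meaningful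
  when the negative part has finite integral, which holds for suprema of Gaussian processes
  over a nonempty index set by the lemma \<open>sup_neg_part_finite\<close> below.\<close>

definition ereal_expectation :: "'a measure \<Rightarrow> ('a \<Rightarrow> ereal) \<Rightarrow> ereal" where
  "ereal_expectation M f =
     enn2ereal (\<integral>\<^sup>+ \<omega>. e2ennreal (f \<omega>) \<partial>M) - enn2ereal (\<integral>\<^sup>+ \<omega>. e2ennreal (- f \<omega>) \<partial>M)"

lemma ereal_expectation_eq_integral:
  assumes "integrable M f"
  shows "ereal_expectation M (\<lambda>\<omega>. ereal (f \<omega>)) = ereal (\<integral>\<omega>. f \<omega> \<partial>M)"
proof -
  have "(\<integral>\<^sup>+ \<omega>. ennreal (f \<omega>) \<partial>M) < \<infinity>" "(\<integral>\<^sup>+ \<omega>. ennreal (- f \<omega>) \<partial>M) < \<infinity>"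
    using assms by (auto simp: real_integrable_def less_top)
  then obtain a b where ab: "(\<integral>\<^sup>+ \<omega>. ennreal (f \<omega>) \<partial>M) = ennreal a" "a \<ge> 0"
      "(\<integral>\<^sup>+ \<omega>. ennreal (- f \<omega>) \<partial>M) = ennreal b" "b \<ge> 0"
    by (metis ennreal_cases infinity_ennreal_def less_irrefl)
  then show ?thesis
    unfolding ereal_expectation_def
    by (simp add: real_lebesgue_integral_def[OF assms] enn2ereal_ennreal)
qed

lemma centered_gaussian_integrable:
  assumes "centered_gaussian M Z"
  shows "integrable M Z"
proof -
  have meas: "Z \<in> borel_measurable M" using assms by (simp add: centered_gaussian_def)
  from assms consider "AE \<omega> in M. Z \<omega> = 0"
    | \<sigma> where "\<sigma> > 0" "distributed M lborel Z (normal_density 0 \<sigma>)"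
    by (auto simp: centered_gaussian_def)
  then show ?thesis
  proof cases
    case 1
    then show ?thesis using meas integrable_cong_AE[of Z M "\<lambda>_. 0"] by simp
  next
    case 2
    then show ?thesis
      using distributed_integrable[OF 2(2), of "\<lambda>x. x"] integrable_normal_moment_nz_1[of \<sigma> 0]
      by (simp add: normal_density_nonneg)
  qed
qed

lemma sup_neg_part_finite:
  assumes "centered_gaussian_process M I X" "I \<noteq> {}"
  shows "(\<integral>\<^sup>+ \<omega>. e2ennreal (- (SUP i\<in>I. ereal (X i \<omega> + m i))) \<partial>M) < \<infinity>"
proof -
  interpret prob_space M using assms(1) by (simp add: centered_gaussian_process_def)
  obtain k where k: "k \<in> I" using assms(2) by auto
  have "\<forall>F c. finite F \<and> F \<subseteq> I \<longrightarrow> centered_gaussian M (\<lambda>\<omega>. \<Sum>i\<in>F. c i * X i \<omega>)"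
    using assms(1) unfolding centered_gaussian_process_def by (rule conjunct2)
  from this[THEN spec, of "{k}", THEN spec, of "\<lambda>_. 1"]
  have "centered_gaussian M (X k)" using k by simp
  then have "integrable M (X k)" by (rule centered_gaussian_integrable)
  then have int: "integrable M (\<lambda>\<omega>. X k \<omega> + m k)" by simp
  have "(\<integral>\<^sup>+ \<omega>. e2ennreal (- (SUP i\<in>I. ereal (X i \<omega> + m i))) \<partial>M)
      \<le> (\<integral>\<^sup>+ \<omega>. e2ennreal (- ereal (X k \<omega> + m k)) \<partial>M)"
    by (intro nn_integral_mono e2ennreal_mono)
       (simp only: ereal_minus_le_minus, rule SUP_upper[OF k])
  also have "\<dots> = (\<integral>\<^sup>+ \<omega>. ennreal (- (X k \<omega> + m k)) \<partial>M)"
    by (simp only: uminus_ereal.simps e2ennreal_ereal)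
  also have "\<dots> < \<infinity>" using int by (simp add: real_integrable_def less_top)
  finally show ?thesis .
qed

end

theory Submission
  imports Defs
begin

text \<open>For finite \<open>I\<close>, replace the maximum by the smooth \<open>ln (\<Sum>i. exp (w i))\<close>, whose second-order term in
  direction \<open>x\<close> is \<open>1/4 \<Sum>i j. p i p j (x i - x j)\<^sup>2\<close> with \<open>p\<close> the softmax weights: only the variances of
  the increments enter, with nonnegative coefficients. Following Lindeberg, one passes from \<open>X\<close> to
  \<open>Y\<close> in \<open>n\<close> steps: by stability of Gaussian laws, \<open>sqrt (1 - k/n) X + sqrt (k/n) Y\<close> has the law of a
  common part plus an independent copy of \<open>X / sqrt n\<close>, and exchanging the latter for \<open>Y / sqrt n\<close>
  decreases the expectation by at most \<open>O(n powr (-3/2))\<close>. The total error \<open>O(1 / sqrt n)\<close> vanishes.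
  Scaling both processes and \<open>m\<close> by \<open>b\<close> and letting \<open>b\<close> tend to infinity recovers the maximum;
  monotone convergence along finite subsets gives countable \<open>I\<close>.\<close>

subsection \<open>Joint laws are determined by trigonometric integrals\<close>

lemma (in prob_space) integrable_bounded:
  fixes f :: "'a \<Rightarrow> real"
  assumes "f \<in> borel_measurable M" "\<And>\<omega>. \<bar>f \<omega>\<bar> \<le> C"
  shows "integrable M f"
  by (rule integrable_const_bound[of _ C]) (use assms in auto)

lemma (in prob_space) char_distr_eq:
  assumes [measurable]: "X \<in> borel_measurable M"
  shows "char (distr M borel X) u = Complex (\<integral>\<omega>. cos (u * X \<omega>) \<partial>M) (\<integral>\<omega>. sin (u * X \<omega>) \<partial>M)"
proof -
  have int: "complex_integrable M (\<lambda>\<omega>. iexp (u * X \<omega>))"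
    by (intro integrable_iexp) auto
  have "char (distr M borel X) u = (CLINT \<omega>|M. iexp (u * X \<omega>))"
    unfolding char_def by (simp add: integral_distr)
  also have "\<dots> = Complex (\<integral>\<omega>. cos (u * X \<omega>) \<partial>M) (\<integral>\<omega>. sin (u * X \<omega>) \<partial>M)"
    using integral_Re[OF int] integral_Im[OF int]
    by (simp add: complex_eq_iff Re_exp Im_exp)
  finally show ?thesis .
qed

lemma integral_eq_of_distr_eq:
  fixes f :: "'c \<Rightarrow> real"
  assumes "distr M L X = distr N L Y"
    and "X \<in> measurable M L" "Y \<in> measurable N L" "f \<in> borel_measurable L"
  shows "(\<integral>\<omega>. f (X \<omega>) \<partial>M) = (\<integral>\<omega>. f (Y \<omega>) \<partial>N)"
  using integral_distr[OF assms(2,4)] integral_distr[OF assms(3,4)] assms(1) by simp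

text \<open>The two integrals are the real and imaginary parts of the characteristic function, so
  Levy's uniqueness theorem applies.\<close>

lemma distr_eqI_trig:
  fixes X :: "'a \<Rightarrow> real" and Y :: "'b \<Rightarrow> real"
  assumes "prob_space M" "prob_space N"
    and [measurable]: "X \<in> borel_measurable M" "Y \<in> borel_measurable N"
    and "\<And>u. (\<integral>\<omega>. cos (u * X \<omega>) \<partial>M) = (\<integral>\<omega>. cos (u * Y \<omega>) \<partial>N)"
    and "\<And>u. (\<integral>\<omega>. sin (u * X \<omega>) \<partial>M) = (\<integral>\<omega>. sin (u * Y \<omega>) \<partial>N)"
  shows "distr M borel X = distr N borel Y"
proof -
  interpret M: prob_space M by fact
  interpret N: prob_space N by fact
  show ?thesis
  proof (rule Levy_uniqueness)
    show "char (distr M borel X) = char (distr N borel Y)"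
      using assms(5,6) by (simp add: M.char_distr_eq N.char_distr_eq fun_eq_iff)
  qed simp_all
qed

text \<open>Since \<open>G + 2\<close> takes values in [1, 3], dividing by its mean \<open>c\<close>
  yields a probability density. The last claim is what allows the \<open>G\<close>-weighted integral
  to be recovered from a tilted and an untilted one.\<close>

lemma prob_space_tilt:
  assumes "prob_space M" and [measurable]: "G \<in> borel_measurable M"
    and G: "\<And>\<omega>. \<bar>G \<omega>\<bar> \<le> (1::real)" and c: "c = (\<integral>\<omega>. G \<omega> \<partial>M) + 2"
  shows "prob_space (density M (\<lambda>\<omega>. ennreal ((G \<omega> + 2) / c)))" "c > 0"
    and "\<And>f C. f \<in> borel_measurable M \<Longrightarrow> (\<And>\<omega>. \<bar>f \<omega>\<bar> \<le> C) \<Longrightarrow>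
      (\<integral>\<omega>. f \<omega> \<partial>density M (\<lambda>\<omega>. ennreal ((G \<omega> + 2) / c)))
        = ((\<integral>\<omega>. G \<omega> * f \<omega> \<partial>M) + 2 * (\<integral>\<omega>. f \<omega> \<partial>M)) / c"
proof -
  interpret prob_space M by fact
  have intG: "integrable M G" by (rule integrable_bounded) (use G in auto)
  have "(\<integral>\<omega>. -1 \<partial>M) \<le> (\<integral>\<omega>. G \<omega> \<partial>M)"
    using G intG by (intro integral_mono) (auto simp: abs_le_iff minus_le_iff)
  then show c0: "c > 0" by (simp add: c prob_space)
  have nn: "0 \<le> (G \<omega> + 2) / c" for \<omega>
    using G[of \<omega>] c0 by simp
  have "(\<integral>\<^sup>+\<omega>. ennreal ((G \<omega> + 2) / c) \<partial>M) = ennreal (\<integral>\<omega>. (G \<omega> + 2) / c \<partial>M)"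
    using nn intG by (intro nn_integral_eq_integral) auto
  also have "(\<integral>\<omega>. (G \<omega> + 2) / c \<partial>M) = 1"
    using intG c0 by (simp add: prob_space c)
  finally show "prob_space (density M (\<lambda>\<omega>. ennreal ((G \<omega> + 2) / c)))"
    by (intro prob_spaceI) (simp add: emeasure_density)
  fix f :: "'a \<Rightarrow> real" and C assume [measurable]: "f \<in> borel_measurable M" and f: "\<And>\<omega>. \<bar>f \<omega>\<bar> \<le> C"
  have "integrable M f" by (rule integrable_bounded) (use f in auto)
  moreover have "integrable M (\<lambda>\<omega>. G \<omega> * f \<omega>)"
  proof (rule integrable_bounded)
    show "\<bar>G \<omega> * f \<omega>\<bar> \<le> C" for \<omega>
      using mult_mono[OF G[of \<omega>] f[of \<omega>]] by (simp add: abs_mult)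
  qed simp
  moreover have "(\<integral>\<omega>. f \<omega> \<partial>density M (\<lambda>\<omega>. ennreal ((G \<omega> + 2) / c)))
      = (\<integral>\<omega>. (G \<omega> * f \<omega> + 2 * f \<omega>) / c \<partial>M)"
    using nn by (subst integral_density) (auto simp: algebra_simps)
  ultimately show "(\<integral>\<omega>. f \<omega> \<partial>density M (\<lambda>\<omega>. ennreal ((G \<omega> + 2) / c)))
        = ((\<integral>\<omega>. G \<omega> * f \<omega> \<partial>M) + 2 * (\<integral>\<omega>. f \<omega> \<partial>M)) / c"
    by simp
qed

text \<open>Adding 2 to the weights makes them positive, so that Levy's uniqueness theorem applies
  to the tilted probability measures.\<close>

lemma weighted_uniqueness:
  fixes X :: "'a \<Rightarrow> real" and Y :: "'b \<Rightarrow> real"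
  assumes "prob_space M" "prob_space N"
    and [measurable]: "X \<in> borel_measurable M" "Y \<in> borel_measurable N"
      "G \<in> borel_measurable M" "H \<in> borel_measurable N" "B \<in> sets borel"
    and G: "\<And>\<omega>. \<bar>G \<omega>\<bar> \<le> (1::real)" and H: "\<And>\<omega>. \<bar>H \<omega>\<bar> \<le> (1::real)"
    and cosXY: "\<And>u. (\<integral>\<omega>. cos (u * X \<omega>) \<partial>M) = (\<integral>\<omega>. cos (u * Y \<omega>) \<partial>N)"
    and sinXY: "\<And>u. (\<integral>\<omega>. sin (u * X \<omega>) \<partial>M) = (\<integral>\<omega>. sin (u * Y \<omega>) \<partial>N)"
    and cosGH: "\<And>u. (\<integral>\<omega>. G \<omega> * cos (u * X \<omega>) \<partial>M) = (\<integral>\<omega>. H \<omega> * cos (u * Y \<omega>) \<partial>N)"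
    and sinGH: "\<And>u. (\<integral>\<omega>. G \<omega> * sin (u * X \<omega>) \<partial>M) = (\<integral>\<omega>. H \<omega> * sin (u * Y \<omega>) \<partial>N)"
  shows "(\<integral>\<omega>. G \<omega> * indicator B (X \<omega>) \<partial>M) = (\<integral>\<omega>. H \<omega> * indicator B (Y \<omega>) \<partial>N)"
proof -
  define c where "c = (\<integral>\<omega>. G \<omega> \<partial>M) + 2"
  \<comment> \<open>At \<open>u = 0\<close> the hypothesis \<open>cosGH\<close> says that the two
    weights have the same mean, so one normalizing constant serves both tilts.\<close>
  have c': "c = (\<integral>\<omega>. H \<omega> \<partial>N) + 2"
    using cosGH[of 0] by (simp add: c_def)
  let ?M = "density M (\<lambda>\<omega>. ennreal ((G \<omega> + 2) / c))"
  let ?N = "density N (\<lambda>\<omega>. ennreal ((H \<omega> + 2) / c))"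
  note M = prob_space_tilt[OF assms(1,5) G c_def]
  note N = prob_space_tilt[OF assms(2,6) H c']
  have "distr ?M borel X = distr ?N borel Y"
    using M(1) N(1)
    by (rule distr_eqI_trig)
       (simp_all add: M(3)[of _ 1] N(3)[of _ 1] cosXY sinXY cosGH sinGH)
  then have "(\<integral>\<omega>. indicat_real B (X \<omega>) \<partial>?M) = (\<integral>\<omega>. indicat_real B (Y \<omega>) \<partial>?N)"
    by (rule integral_eq_of_distr_eq) simp_all
  \<comment> \<open>The untilted laws agree as well, so the contribution of the constant weight 2
    cancels and only the weights \<open>G\<close> and \<open>H\<close> remain.\<close>
  moreover have "distr M borel X = distr N borel Y"
    using assms(1,2) by (rule distr_eqI_trig) (simp_all add: cosXY sinXY)
  then have "(\<integral>\<omega>. indicat_real B (X \<omega>) \<partial>M) = (\<integral>\<omega>. indicat_real B (Y \<omega>) \<partial>N)"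
    by (rule integral_eq_of_distr_eq) simp_all
  moreover have ind: "\<bar>indicator B x :: real\<bar> \<le> 1" for x :: real by (simp add: indicator_def)
  ultimately show ?thesis
    using M(2) by (simp add: M(3)[OF _ ind] N(3)[OF _ ind])
qed

lemma sum_fun_upd_add:
  fixes x :: "'i \<Rightarrow> real"
  assumes "finite I" "j \<in> I"
  shows "(\<Sum>i\<in>I. (c(j := c j + u)) i * x i) = (\<Sum>i\<in>I. c i * x i) + u * x j"
proof -
  have "(\<Sum>i\<in>I. (c(j := c j + u)) i * x i) = (\<Sum>i\<in>I. c i * x i + (if i = j then u * x j else 0))"
    by (intro sum.cong) (auto simp: algebra_simps)
  then show ?thesis using assms by (simp add: sum.distrib)
qed

section \<open>Box probabilities, one coordinate at a time\<close>

lemma prod_indicator_bounds: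
  "0 \<le> (\<Prod>j\<in>J. indicat_real (B j) (x j))" "(\<Prod>j\<in>J. indicat_real (B j) (x j)) \<le> 1"
  by (auto intro!: prod_nonneg prod_le_1 simp: indicator_def)

lemma abs_prod_indicator_mult_cos_le:
  "\<bar>(\<Prod>j\<in>J. indicat_real (B j) (x j)) * cos y\<bar> \<le> 1"
  using mult_mono[of "\<bar>\<Prod>j\<in>J. indicat_real (B j) (x j)\<bar>" 1 "\<bar>cos y\<bar>" 1]
    prod_indicator_bounds[of B x J] by (simp add: abs_mult)

lemma borel_measurable_prod_indicator_mult_cos:
  assumes "\<And>i. i \<in> J \<Longrightarrow> X i \<in> borel_measurable M" "Z \<in> borel_measurable M" "\<And>i. B i \<in> sets borel"
  shows "(\<lambda>\<omega>. (\<Prod>j\<in>J. indicat_real (B j) (X j \<omega>)) * cos (Z \<omega>)) \<in> borel_measurable M"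
proof -
  have [measurable]: "(\<lambda>\<omega>. indicat_real (B i) (X i \<omega>)) \<in> borel_measurable M" if "i \<in> J" for i
    using assms(1)[OF that] assms(3)[of i] by measurable
  show ?thesis using assms(2) by measurable
qed

lemma (in prob_space) integrable_prod_indicator_mult_cos:
  assumes "\<And>i. i \<in> J \<Longrightarrow> X i \<in> borel_measurable M" "Z \<in> borel_measurable M" "\<And>i. B i \<in> sets borel"
  shows "integrable M (\<lambda>\<omega>. (\<Prod>j\<in>J. indicat_real (B j) (X j \<omega>)) * cos (Z \<omega>))"
  using borel_measurable_prod_indicator_mult_cos[OF assms] abs_prod_indicator_mult_cos_le
  by (rule integrable_bounded)

text \<open>The product-to-sum formulas absorb the factor in \<open>X j\<close> into the linear
  combination: the coefficient at \<open>j\<close> moves by \<open>u\<close> or \<open>-u\<close>,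
  and a sine costs a phase shift of \<open>pi / 2\<close>. Such integrals are the inputs of
  \<open>weighted_uniqueness\<close>, with the indicator product times the phased cosine as
  weight.\<close>

lemma (in prob_space) integral_prod_indicator_mult_trig:
  assumes "finite I" "J \<subseteq> I" "j \<in> I"
    and meas: "\<And>i. i \<in> I \<Longrightarrow> X i \<in> borel_measurable M" "\<And>i. B i \<in> sets borel"
  defines "E \<equiv> \<lambda>c \<theta>. \<integral>\<omega>. (\<Prod>j\<in>J. indicat_real (B j) (X j \<omega>)) * cos ((\<Sum>i\<in>I. c i * X i \<omega>) + \<theta>) \<partial>M"
  shows "(\<integral>\<omega>. (\<Prod>j\<in>J. indicat_real (B j) (X j \<omega>)) * cos ((\<Sum>i\<in>I. c i * X i \<omega>) + \<theta>) * cos (u * X j \<omega>) \<partial>M)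
      = (E (c(j := c j + u)) \<theta> + E (c(j := c j + (-u))) \<theta>) / 2"
    and "(\<integral>\<omega>. (\<Prod>j\<in>J. indicat_real (B j) (X j \<omega>)) * cos ((\<Sum>i\<in>I. c i * X i \<omega>) + \<theta>) * sin (u * X j \<omega>) \<partial>M)
      = (E (c(j := c j + u)) (\<theta> - pi / 2) - E (c(j := c j + (-u))) (\<theta> - pi / 2)) / 2"
proof -
  have [measurable]: "(\<lambda>\<omega>. \<Sum>i\<in>I. c i * X i \<omega>) \<in> borel_measurable M" for c
    using meas(1) by (intro borel_measurable_sum) auto
  have int: "integrable M (\<lambda>\<omega>. (\<Prod>j\<in>J. indicat_real (B j) (X j \<omega>)) * cos ((\<Sum>i\<in>I. c i * X i \<omega>) + \<theta>))" for c \<theta>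
    using meas assms(2) by (intro integrable_prod_indicator_mult_cos) auto
  have shift: "(\<Sum>i\<in>I. (c(j := c j + u)) i * X i \<omega>) = (\<Sum>i\<in>I. c i * X i \<omega>) + u * X j \<omega>" for u \<omega>
    using assms(1,3) by (rule sum_fun_upd_add)
  have "cos ((\<Sum>i\<in>I. c i * X i \<omega>) + \<theta>) * cos (u * X j \<omega>)
     = (cos ((\<Sum>i\<in>I. (c(j := c j + u)) i * X i \<omega>) + \<theta>) + cos ((\<Sum>i\<in>I. (c(j := c j + (-u))) i * X i \<omega>) + \<theta>)) / 2" for \<omega>
    unfolding shift cos_times_cos by (simp add: algebra_simps)
  then have eq: "(\<Prod>j\<in>J. indicat_real (B j) (X j \<omega>)) * cos ((\<Sum>i\<in>I. c i * X i \<omega>) + \<theta>) * cos (u * X j \<omega>)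
     = ((\<Prod>j\<in>J. indicat_real (B j) (X j \<omega>)) * cos ((\<Sum>i\<in>I. (c(j := c j + u)) i * X i \<omega>) + \<theta>)
       + (\<Prod>j\<in>J. indicat_real (B j) (X j \<omega>)) * cos ((\<Sum>i\<in>I. (c(j := c j + (-u))) i * X i \<omega>) + \<theta>)) / 2" for \<omega>
    by (metis (no_types, lifting) distrib_left mult.assoc times_divide_eq_right)
  show "(\<integral>\<omega>. (\<Prod>j\<in>J. indicat_real (B j) (X j \<omega>)) * cos ((\<Sum>i\<in>I. c i * X i \<omega>) + \<theta>) * cos (u * X j \<omega>) \<partial>M)
      = (E (c(j := c j + u)) \<theta> + E (c(j := c j + (-u))) \<theta>) / 2"
    unfolding E_def eq using int by (simp del: fun_upd_apply)
  have sin: "cos (x + (\<theta> - pi / 2)) = sin (x + \<theta>)" for x :: real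
    by (simp add: cos_add sin_add cos_diff sin_diff)
  have "cos ((\<Sum>i\<in>I. c i * X i \<omega>) + \<theta>) * sin (u * X j \<omega>)
     = (cos ((\<Sum>i\<in>I. (c(j := c j + u)) i * X i \<omega>) + (\<theta> - pi / 2)) - cos ((\<Sum>i\<in>I. (c(j := c j + (-u))) i * X i \<omega>) + (\<theta> - pi / 2))) / 2" for \<omega>
    unfolding shift sin cos_times_sin by (simp add: algebra_simps)
  then have eq: "(\<Prod>j\<in>J. indicat_real (B j) (X j \<omega>)) * cos ((\<Sum>i\<in>I. c i * X i \<omega>) + \<theta>) * sin (u * X j \<omega>)
     = ((\<Prod>j\<in>J. indicat_real (B j) (X j \<omega>)) * cos ((\<Sum>i\<in>I. (c(j := c j + u)) i * X i \<omega>) + (\<theta> - pi / 2))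
       - (\<Prod>j\<in>J. indicat_real (B j) (X j \<omega>)) * cos ((\<Sum>i\<in>I. (c(j := c j + (-u))) i * X i \<omega>) + (\<theta> - pi / 2))) / 2" for \<omega>
    by (metis (no_types, lifting) right_diff_distrib mult.assoc times_divide_eq_right)
  show "(\<integral>\<omega>. (\<Prod>j\<in>J. indicat_real (B j) (X j \<omega>)) * cos ((\<Sum>i\<in>I. c i * X i \<omega>) + \<theta>) * sin (u * X j \<omega>) \<partial>M)
      = (E (c(j := c j + u)) (\<theta> - pi / 2) - E (c(j := c j + (-u))) (\<theta> - pi / 2)) / 2"
    unfolding E_def eq using int by (simp del: fun_upd_apply)
qed

text \<open>Induction on \<open>J\<close>: the integrand for \<open>J\<close> is the weight, and
  \<open>weighted_uniqueness\<close> for the variables \<open>X j\<close> and \<open>Y j\<close>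
  supplies the indicator of the new coordinate \<open>j\<close>. The induction hypothesis is used at
  shifted coefficients and phases, so \<open>c\<close> and \<open>\<theta>\<close> must stay
  arbitrary.\<close>

lemma integral_prod_indicator_eqI:
  fixes X :: "'i \<Rightarrow> 'a \<Rightarrow> real" and Y :: "'i \<Rightarrow> 'b \<Rightarrow> real"
  assumes "prob_space M" "prob_space N" "finite I"
    and X: "\<And>i. i \<in> I \<Longrightarrow> X i \<in> borel_measurable M"
    and Y: "\<And>i. i \<in> I \<Longrightarrow> Y i \<in> borel_measurable N"
    and B: "\<And>i. B i \<in> sets borel"
    and eq: "\<And>c \<theta>. (\<integral>\<omega>. cos ((\<Sum>i\<in>I. c i * X i \<omega>) + \<theta>) \<partial>M) = (\<integral>\<omega>. cos ((\<Sum>i\<in>I. c i * Y i \<omega>) + \<theta>) \<partial>N)"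
  assumes "finite J" "J \<subseteq> I"
  shows "(\<integral>\<omega>. (\<Prod>j\<in>J. indicat_real (B j) (X j \<omega>)) * cos ((\<Sum>i\<in>I. c i * X i \<omega>) + \<theta>) \<partial>M)
       = (\<integral>\<omega>. (\<Prod>j\<in>J. indicat_real (B j) (Y j \<omega>)) * cos ((\<Sum>i\<in>I. c i * Y i \<omega>) + \<theta>) \<partial>N)"
  using assms(8,9)
proof (induction J arbitrary: c \<theta> rule: finite_induct)
  case empty
  then show ?case using eq by simp
next
  case (insert j J)
  then have j: "j \<in> I" and J: "J \<subseteq> I" by auto
  note [measurable] = X[OF j] Y[OF j]
  note M = prob_space.integral_prod_indicator_mult_trig[OF assms(1,3) _ j, where X = X and B = B, OF _ X B]
  note N = prob_space.integral_prod_indicator_mult_trig[OF assms(2,3) _ j, where X = Y and B = B, OF _ Y B]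
  have meas:
    "(\<lambda>\<omega>. (\<Prod>j\<in>J. indicat_real (B j) (X j \<omega>)) * cos ((\<Sum>i\<in>I. c i * X i \<omega>) + \<theta>)) \<in> borel_measurable M"
    "(\<lambda>\<omega>. (\<Prod>j\<in>J. indicat_real (B j) (Y j \<omega>)) * cos ((\<Sum>i\<in>I. c i * Y i \<omega>) + \<theta>)) \<in> borel_measurable N"
    using J X Y B
    by (intro borel_measurable_prod_indicator_mult_cos borel_measurable_add borel_measurable_sum
        borel_measurable_times; auto)+
  have "(\<integral>\<omega>. (\<Prod>j\<in>J. indicat_real (B j) (X j \<omega>)) * cos ((\<Sum>i\<in>I. c i * X i \<omega>) + \<theta>) * indicat_real (B j) (X j \<omega>) \<partial>M)
      = (\<integral>\<omega>. (\<Prod>j\<in>J. indicat_real (B j) (Y j \<omega>)) * cos ((\<Sum>i\<in>I. c i * Y i \<omega>) + \<theta>) * indicat_real (B j) (Y j \<omega>) \<partial>N)"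
  proof (rule weighted_uniqueness[OF assms(1,2) X[OF j] Y[OF j] meas B abs_prod_indicator_mult_cos_le abs_prod_indicator_mult_cos_le])
    fix u
    \<comment> \<open>The unweighted hypotheses are the case of an empty product, zero coefficients
      and zero phase, where the weight is constantly 1.\<close>
    show "(\<integral>\<omega>. cos (u * X j \<omega>) \<partial>M) = (\<integral>\<omega>. cos (u * Y j \<omega>) \<partial>N)"
      using M(1)[where J = "{}" and c = "\<lambda>_. 0" and \<theta> = 0 and u = u] N(1)[where J = "{}" and c = "\<lambda>_. 0" and \<theta> = 0 and u = u] by (simp add: eq[of _ 0, simplified] del: fun_upd_apply)
    show "(\<integral>\<omega>. sin (u * X j \<omega>) \<partial>M) = (\<integral>\<omega>. sin (u * Y j \<omega>) \<partial>N)"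
      using M(2)[where J = "{}" and c = "\<lambda>_. 0" and \<theta> = 0 and u = u] N(2)[where J = "{}" and c = "\<lambda>_. 0" and \<theta> = 0 and u = u] by (simp add: eq[of _ "-pi/2", simplified] del: fun_upd_apply)
  qed (simp_all only: M[OF J] N[OF J] insert.IH[OF J])
  then show ?case
    using insert.hyps by (simp add: mult_ac)
qed

text \<open>A Cramer--Wold type statement: including all phases \<open>\<theta>\<close> makes the real integrals below carry the same
  information as the joint characteristic function.\<close>

lemma distr_PiM_eqI_trig:
  fixes X :: "'i \<Rightarrow> 'a \<Rightarrow> real" and Y :: "'i \<Rightarrow> 'b \<Rightarrow> real"
  assumes "prob_space M" "prob_space N" "finite I"
    and X: "\<And>i. i \<in> I \<Longrightarrow> X i \<in> borel_measurable M"
    and Y: "\<And>i. i \<in> I \<Longrightarrow> Y i \<in> borel_measurable N"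
    and eq: "\<And>c \<theta>. (\<integral>\<omega>. cos ((\<Sum>i\<in>I. c i * X i \<omega>) + \<theta>) \<partial>M) = (\<integral>\<omega>. cos ((\<Sum>i\<in>I. c i * Y i \<omega>) + \<theta>) \<partial>N)"
  shows "distr M (PiM I (\<lambda>_. borel)) (\<lambda>\<omega>. \<lambda>i\<in>I. X i \<omega>) = distr N (PiM I (\<lambda>_. borel)) (\<lambda>\<omega>. \<lambda>i\<in>I. Y i \<omega>)"
    (is "?P = ?Q")
proof -
  \<comment> \<open>Boxes generate the product sigma-algebra and are stable under intersection, so
    it suffices to compare their measures. The formula is stated for a generic space in order to
    serve both sides.\<close>
  have box: "emeasure (distr M (PiM I (\<lambda>_. borel)) (\<lambda>\<omega>. \<lambda>i\<in>I. X i \<omega>)) (Pi\<^sub>E I A)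
      = ennreal (\<integral>\<omega>. (\<Prod>i\<in>I. indicat_real (A i) (X i \<omega>)) \<partial>M)"
    if "prob_space M" and X: "\<And>i. i \<in> I \<Longrightarrow> X i \<in> borel_measurable M" and A: "\<And>i. A i \<in> sets borel"
    for M :: "'c measure" and X A
  proof -
    interpret prob_space M by fact
    have [measurable]: "(\<lambda>\<omega>. \<lambda>i\<in>I. X i \<omega>) \<in> measurable M (PiM I (\<lambda>_. borel))"
      using X by (intro measurable_restrict) auto
    have [measurable]: "Pi\<^sub>E I A \<in> sets (PiM I (\<lambda>_. borel))"
      using A assms(3) by (intro sets_PiM_I_finite) auto
    have ind: "indicator (Pi\<^sub>E I A) (\<lambda>i\<in>I. x i) = ennreal (\<Prod>i\<in>I. indicat_real (A i) (x i))" for x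
    proof (cases "\<forall>i\<in>I. x i \<in> A i")
      case False
      then have "(\<Prod>i\<in>I. indicat_real (A i) (x i)) = 0"
        using assms(3) by (intro prod_zero) (auto simp: indicator_def)
      moreover have "(\<lambda>i\<in>I. x i) \<notin> Pi\<^sub>E I A"
        using False by (auto simp: PiE_iff)
      ultimately show ?thesis by simp
    qed (auto simp: PiE_iff)
    have "emeasure (distr M (PiM I (\<lambda>_. borel)) (\<lambda>\<omega>. \<lambda>i\<in>I. X i \<omega>)) (Pi\<^sub>E I A)
        = (\<integral>\<^sup>+\<omega>. indicator (Pi\<^sub>E I A) (\<lambda>i\<in>I. X i \<omega>) \<partial>M)"
      by (subst nn_integral_indicator[symmetric]) (simp_all add: nn_integral_distr del: nn_integral_indicator)
    also have "\<dots> = ennreal (\<integral>\<omega>. (\<Prod>i\<in>I. indicat_real (A i) (X i \<omega>)) \<partial>M)"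
      unfolding ind
      using integrable_prod_indicator_mult_cos[of I X "\<lambda>_. 0" A] X A
      by (intro nn_integral_eq_integral) (auto simp: prod_indicator_bounds)
    finally show ?thesis .
  qed
  interpret P: prob_space ?P
    using X by (intro prob_space.prob_space_distr assms(1) measurable_restrict) auto
  show ?thesis
  proof (rule measure_eqI_PiM_finite[OF assms(3), where M = "\<lambda>_. borel"])
    fix A :: "'i \<Rightarrow> real set" assume A: "\<And>i. i \<in> I \<Longrightarrow> A i \<in> sets borel"
    \<comment> \<open>The sets \<open>A i\<close> are known to be Borel only for
      \<open>i \<in> I\<close>; \<open>A'\<close> is Borel at every index and describes the same
      box.\<close>
    define A' where "A' i = (if i \<in> I then A i else {})" for i
    have A': "A' i \<in> sets borel" for i using A by (simp add: A'_def)
    have "Pi\<^sub>E I A = Pi\<^sub>E I A'" by (intro PiE_cong) (simp add: A'_def)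
    moreover have "emeasure ?P (Pi\<^sub>E I A') = emeasure ?Q (Pi\<^sub>E I A')"
      using integral_prod_indicator_eqI[OF assms(1,2,3) X Y A' eq assms(3) subset_refl, where c = "\<lambda>_. 0" and \<theta> = 0]
      by (simp add: box[OF assms(1) X A'] box[OF assms(2) Y A'])
    ultimately show "emeasure ?P (Pi\<^sub>E I A) = emeasure ?Q (Pi\<^sub>E I A)" by simp
  next
    show "range (\<lambda>_. Pi\<^sub>E I (\<lambda>_. UNIV)) \<subseteq> prod_algebra I (\<lambda>_. borel :: real measure)"
      using assms(3) by (auto intro!: prod_algebraI_finite)
  qed (auto simp: space_PiM)
qed

subsection \<open>Gaussian families\<close>

text \<open>A degenerate variable reduces to evaluation at 0; otherwise the moments of the normal
  density apply. In the cosine formula the sine part vanishes, because the characteristic function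
  is real. The third absolute moment will control the Taylor remainder.\<close>

lemma centered_gaussian_moments:
  assumes "prob_space M" "centered_gaussian M Z"
  shows "(\<integral>\<omega>. Z \<omega> \<partial>M) = 0" "integrable M (\<lambda>\<omega>. (Z \<omega>)\<^sup>2)" "integrable M (\<lambda>\<omega>. \<bar>Z \<omega>\<bar> ^ 3)"
    and "(\<integral>\<omega>. cos (Z \<omega> + \<theta>) \<partial>M) = cos \<theta> * exp (- (\<integral>\<omega>. (Z \<omega>)\<^sup>2 \<partial>M) / 2)"
proof -
  interpret prob_space M by fact
  have [measurable]: "Z \<in> borel_measurable M" using assms(2) by (simp add: centered_gaussian_def)
  from assms(2) consider "AE \<omega> in M. Z \<omega> = 0"
    | \<sigma> where "\<sigma> > 0" "distributed M lborel Z (normal_density 0 \<sigma>)"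
    by (auto simp: centered_gaussian_def)
  then have "(\<integral>\<omega>. Z \<omega> \<partial>M) = 0 \<and> integrable M (\<lambda>\<omega>. (Z \<omega>)\<^sup>2) \<and> integrable M (\<lambda>\<omega>. \<bar>Z \<omega>\<bar> ^ 3)
    \<and> (\<integral>\<omega>. cos (Z \<omega> + \<theta>) \<partial>M) = cos \<theta> * exp (- (\<integral>\<omega>. (Z \<omega>)\<^sup>2 \<partial>M) / 2)"
  proof cases
    case 1
    then have "(\<integral>\<omega>. f (Z \<omega>) \<partial>M) = f 0" "integrable M (\<lambda>\<omega>. f (Z \<omega>))"
      if [measurable]: "f \<in> borel_measurable borel" for f :: "real \<Rightarrow> real"
    proof -
      have "AE \<omega> in M. f (Z \<omega>) = f 0" using 1 by eventually_elim simp
      then show "(\<integral>\<omega>. f (Z \<omega>) \<partial>M) = f 0" "integrable M (\<lambda>\<omega>. f (Z \<omega>))"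
        using integral_cong_AE[of "\<lambda>\<omega>. f (Z \<omega>)" M "\<lambda>_. f 0"] integrable_cong_AE[of "\<lambda>\<omega>. f (Z \<omega>)" M "\<lambda>_. f 0"]
        by (auto simp: prob_space)
    qed
    from this[of "\<lambda>x. x"] this[of "\<lambda>x. x\<^sup>2"] this[of "\<lambda>x. \<bar>x\<bar> ^ 3"] this[of "\<lambda>x. cos (x + \<theta>)"]
    show ?thesis by simp
  next
    case 2
    note int = distributed_integrable[OF 2(2), THEN iffD1] and eq = distributed_integral[OF 2(2), symmetric]
    have "(\<integral>\<omega>. Z \<omega> \<partial>M) = 0"
      using eq[of "\<lambda>x. x"] integral_normal_moment_nz_1[OF 2(1), of 0] by simp
    moreover have "integrable M (\<lambda>\<omega>. (Z \<omega>)\<^sup>2)"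
      using int[of "\<lambda>x. x\<^sup>2"] integrable_normal_moment[OF 2(1), of 0 2] by simp
    moreover have "integrable M (\<lambda>\<omega>. \<bar>Z \<omega>\<bar> ^ 3)"
      using int[of "\<lambda>x. \<bar>x\<bar> ^ 3"] integrable_normal_moment_abs[OF 2(1), of 0 3] by simp
    moreover have "(\<integral>\<omega>. cos (Z \<omega> + \<theta>) \<partial>M) = cos \<theta> * exp (- (\<integral>\<omega>. (Z \<omega>)\<^sup>2 \<partial>M) / 2)"
    proof -
      have var: "(\<integral>\<omega>. (Z \<omega>)\<^sup>2 \<partial>M) = \<sigma>\<^sup>2"
        using eq[of "\<lambda>x. x\<^sup>2"] integral_normal_moment_even[OF 2(1), of 0 1] 2(1)
        by (simp add: power2_eq_square fact_2)
      have "distributed M lborel (\<lambda>\<omega>. Z \<omega> / \<sigma>) std_normal_density"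
        using 2 normal_standard_normal_convert[of \<sigma> Z 0] by simp
      then have "distr M lborel (\<lambda>\<omega>. Z \<omega> / \<sigma>) = std_normal_distribution"
        by (rule distributed_distr_eq_density)
      moreover have "distr M lborel (\<lambda>\<omega>. Z \<omega> / \<sigma>) = distr M borel (\<lambda>\<omega>. Z \<omega> / \<sigma>)"
        by (rule distr_cong) auto
      \<comment> \<open>Evaluating the characteristic function of \<open>Z / \<sigma>\<close> at
        \<open>\<sigma>\<close> undoes the standardization and gives the trigonometric integrals of
        \<open>Z\<close> itself.\<close>
      ultimately have "char (distr M borel (\<lambda>\<omega>. Z \<omega> / \<sigma>)) \<sigma> = complex_of_real (exp (- (\<sigma>\<^sup>2) / 2))"
        by (simp add: char_std_normal_distribution)
      then have trig: "(\<integral>\<omega>. cos (Z \<omega>) \<partial>M) = exp (- (\<sigma>\<^sup>2) / 2)" "(\<integral>\<omega>. sin (Z \<omega>) \<partial>M) = 0"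
        using 2(1) by (simp_all add: char_distr_eq complex_eq_iff)
      have "integrable M (\<lambda>\<omega>. cos (Z \<omega>))" "integrable M (\<lambda>\<omega>. sin (Z \<omega>))"
        by (rule integrable_bounded[of _ 1]; simp)+
      then show ?thesis
        by (simp add: cos_add trig var)
    qed
    ultimately show ?thesis by simp
  qed
  then show "(\<integral>\<omega>. Z \<omega> \<partial>M) = 0" "integrable M (\<lambda>\<omega>. (Z \<omega>)\<^sup>2)" "integrable M (\<lambda>\<omega>. \<bar>Z \<omega>\<bar> ^ 3)"
    "(\<integral>\<omega>. cos (Z \<omega> + \<theta>) \<partial>M) = cos \<theta> * exp (- (\<integral>\<omega>. (Z \<omega>)\<^sup>2 \<partial>M) / 2)" by auto
qed

text \<open>\<open>V c\<close> is the variance of the linear combination with coefficients \<open>c\<close>.\<close>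

definition gaussian_family ::
    "'a measure \<Rightarrow> 'i set \<Rightarrow> ('i \<Rightarrow> 'a \<Rightarrow> real) \<Rightarrow> (('i \<Rightarrow> real) \<Rightarrow> real) \<Rightarrow> bool" where
  "gaussian_family M I X V \<longleftrightarrow> prob_space M \<and> (\<forall>i\<in>I. X i \<in> borel_measurable M) \<and>
     (\<forall>c \<theta>. (\<integral>\<omega>. cos ((\<Sum>i\<in>I. c i * X i \<omega>) + \<theta>) \<partial>M) = cos \<theta> * exp (- V c / 2))"

lemma gaussian_familyD:
  assumes "gaussian_family M I X V"
  shows "prob_space M" "\<And>i. i \<in> I \<Longrightarrow> X i \<in> borel_measurable M"
    and "\<And>c \<theta>. (\<integral>\<omega>. cos ((\<Sum>i\<in>I. c i * X i \<omega>) + \<theta>) \<partial>M) = cos \<theta> * exp (- V c / 2)"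
  using assms by (simp_all add: gaussian_family_def)

lemma centered_gaussian_process_lincomb:
  assumes "centered_gaussian_process M I X" "finite F" "F \<subseteq> I"
  shows "centered_gaussian M (\<lambda>\<omega>. \<Sum>i\<in>F. c i * X i \<omega>)"
  using assms unfolding centered_gaussian_process_def by blast

lemma centered_gaussian_process_component:
  assumes "centered_gaussian_process M I X" "i \<in> I"
  shows "centered_gaussian M (X i)"
  using centered_gaussian_process_lincomb[OF assms(1), of "{i}" "\<lambda>_. 1"] assms(2) by simp

lemma gaussian_family_process:
  assumes "centered_gaussian_process M I X" "finite I"
  shows "gaussian_family M I X (\<lambda>c. \<integral>\<omega>. (\<Sum>i\<in>I. c i * X i \<omega>)\<^sup>2 \<partial>M)"
proof -
  have "prob_space M" using assms(1) by (simp add: centered_gaussian_process_def)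
  moreover have "X i \<in> borel_measurable M" if "i \<in> I" for i
    using centered_gaussian_process_component[OF assms(1) that] by (simp add: centered_gaussian_def)
  ultimately show ?thesis
    using centered_gaussian_moments(4)[OF _ centered_gaussian_process_lincomb[OF assms subset_refl]]
    by (simp add: gaussian_family_def)
qed

text \<open>The factor \<open>a\<close> moves from the variables into the coefficients, where the
  homogeneity of \<open>V\<close> extracts it as a square.\<close>

lemma gaussian_family_scale:
  assumes "gaussian_family M I X V" "\<And>c. V (\<lambda>i. a * c i) = a\<^sup>2 * V c"
  shows "gaussian_family M I (\<lambda>i \<omega>. a * X i \<omega>) (\<lambda>c. a\<^sup>2 * V c)"
proof -
  have "(\<integral>\<omega>. cos ((\<Sum>i\<in>I. c i * (a * X i \<omega>)) + \<theta>) \<partial>M) = cos \<theta> * exp (- (a\<^sup>2 * V c) / 2)" for c \<theta>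
  proof -
    have "(\<integral>\<omega>. cos ((\<Sum>i\<in>I. (a * c i) * X i \<omega>) + \<theta>) \<partial>M) = cos \<theta> * exp (- V (\<lambda>i. a * c i) / 2)"
      by (rule gaussian_familyD(3)[OF assms(1)])
    then show ?thesis by (simp add: assms(2) mult_ac)
  qed
  then show ?thesis
    using gaussian_familyD(1,2)[OF assms(1)] by (auto simp: gaussian_family_def)
qed

text \<open>The product measure makes the two families independent. For a fixed first coordinate the
  combination of the \<open>X i\<close> is merely a phase in the integral over \<open>N\<close>;
  integrating that out leaves the same kind of integral over \<open>M\<close>, and the exponents
  add.\<close>

lemma gaussian_family_add:
  assumes "gaussian_family M I X V" "gaussian_family N I Y W"
  shows "gaussian_family (M \<Otimes>\<^sub>M N) I (\<lambda>i \<omega>. X i (fst \<omega>) + Y i (snd \<omega>)) (\<lambda>c. V c + W c)"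
proof -
  interpret M: prob_space M using assms(1) by (simp add: gaussian_family_def)
  interpret N: prob_space N using assms(2) by (simp add: gaussian_family_def)
  interpret MN: pair_prob_space M N ..
  have meas [measurable]: "X i \<in> borel_measurable M" "Y i \<in> borel_measurable N" if "i \<in> I" for i
    using assms that by (auto simp: gaussian_family_def)
  note X = gaussian_familyD(3)[OF assms(1)]
  note Y = gaussian_familyD(3)[OF assms(2)]
  have sum_meas: "(\<lambda>\<omega>. X i (fst \<omega>) + Y i (snd \<omega>)) \<in> borel_measurable (M \<Otimes>\<^sub>M N)" if "i \<in> I" for i
    using meas[OF that] by measurable
  have "(\<integral>\<omega>. cos ((\<Sum>i\<in>I. c i * (X i (fst \<omega>) + Y i (snd \<omega>))) + \<theta>) \<partial>(M \<Otimes>\<^sub>M N))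
      = cos \<theta> * exp (- (V c + W c) / 2)" for c \<theta>
  proof -
    have "integrable (M \<Otimes>\<^sub>M N) (\<lambda>\<omega>. cos ((\<Sum>i\<in>I. c i * (X i (fst \<omega>) + Y i (snd \<omega>))) + \<theta>))"
    proof (rule MN.integrable_bounded[of _ 1])
      have [measurable]: "(\<lambda>\<omega>. (\<Sum>i\<in>I. c i * (X i (fst \<omega>) + Y i (snd \<omega>)))) \<in> borel_measurable (M \<Otimes>\<^sub>M N)"
        using sum_meas by (intro borel_measurable_sum borel_measurable_times) auto
      show "(\<lambda>\<omega>. cos ((\<Sum>i\<in>I. c i * (X i (fst \<omega>) + Y i (snd \<omega>))) + \<theta>)) \<in> borel_measurable (M \<Otimes>\<^sub>M N)"
        by measurable
    qed simp
    from MN.integral_fst'[OF this]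
    have "(\<integral>\<omega>. cos ((\<Sum>i\<in>I. c i * (X i (fst \<omega>) + Y i (snd \<omega>))) + \<theta>) \<partial>(M \<Otimes>\<^sub>M N))
      = (\<integral>x. (\<integral>y. cos ((\<Sum>i\<in>I. c i * (X i x + Y i y)) + \<theta>) \<partial>N) \<partial>M)" by simp
    also have "\<dots> = (\<integral>x. (\<integral>y. cos ((\<Sum>i\<in>I. c i * Y i y) + ((\<Sum>i\<in>I. c i * X i x) + \<theta>)) \<partial>N) \<partial>M)"
      by (simp add: algebra_simps sum.distrib)
    also have "\<dots> = cos \<theta> * exp (- (V c + W c) / 2)"
      unfolding Y integral_mult_left_zero X mult.assoc exp_add[symmetric] by (simp add: field_simps)
    finally show ?thesis .
  qed
  then show ?thesis
    using sum_meas MN.prob_space_axioms by (simp add: gaussian_family_def)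
qed

text \<open>The function \<open>V\<close> alone fixes the joint law, so realizations on different
  probability spaces are interchangeable inside expectations.\<close>

lemma gaussian_family_integral_eq:
  fixes X :: "'i \<Rightarrow> 'a \<Rightarrow> real" and Y :: "'i \<Rightarrow> 'b \<Rightarrow> real"
  assumes "gaussian_family M I X V" "gaussian_family N I Y V" "finite I"
    and "F \<in> borel_measurable (PiM I (\<lambda>_. borel))"
  shows "(\<integral>\<omega>. F (\<lambda>i\<in>I. X i \<omega>) \<partial>M) = (\<integral>\<omega>. F (\<lambda>i\<in>I. Y i \<omega>) \<partial>N :: real)"
  using assms
  by (intro integral_eq_of_distr_eq[OF distr_PiM_eqI_trig _ _ assms(4)])
     (auto simp: gaussian_family_def intro!: measurable_restrict)

subsection \<open>Taylor expansion of the smooth maximum\<close>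

definition log_sum_exp :: "'i set \<Rightarrow> ('i \<Rightarrow> real) \<Rightarrow> real" where
  "log_sum_exp I w = ln (\<Sum>i\<in>I. exp (w i))"

definition softmax :: "'i set \<Rightarrow> ('i \<Rightarrow> real) \<Rightarrow> 'i \<Rightarrow> real" where
  "softmax I w i = exp (w i) / (\<Sum>j\<in>I. exp (w j))"

lemma sum_exp_pos:
  assumes "finite I" "I \<noteq> {}"
  shows "(\<Sum>i\<in>I. exp (w i :: real)) > 0"
  using assms by (intro sum_pos) auto

lemma softmax_nonneg: "softmax I w i \<ge> 0"
  by (simp add: softmax_def sum_nonneg)

lemma sum_softmax:
  assumes "finite I" "I \<noteq> {}"
  shows "(\<Sum>i\<in>I. softmax I w i) = 1"
  using sum_exp_pos[OF assms, of w] by (simp add: softmax_def sum_divide_distrib[symmetric])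

text \<open>A variance is half the mean square of the difference of two independent copies. This
  form brings in the increments \<open>x i - x j\<close>, which the comparison hypothesis
  controls.\<close>

lemma variance_eq_sum_diff_squares:
  fixes p x :: "'i \<Rightarrow> real"
  assumes "(\<Sum>i\<in>I. p i) = 1"
  shows "(\<Sum>i\<in>I. p i * (x i)\<^sup>2) - (\<Sum>i\<in>I. p i * x i)\<^sup>2
       = (\<Sum>i\<in>I. \<Sum>j\<in>I. p i * p j * (x i - x j)\<^sup>2) / 2"
proof -
  have "(\<Sum>i\<in>I. \<Sum>j\<in>I. p i * p j * (x i - x j)\<^sup>2)
      = (\<Sum>i\<in>I. \<Sum>j\<in>I. (p i * (x i)\<^sup>2) * p j + p i * (p j * (x j)\<^sup>2) - 2 * ((p i * x i) * (p j * x j)))"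
    by (intro sum.cong refl) (simp add: power2_eq_square algebra_simps)
  also have "\<dots> = (\<Sum>i\<in>I. p i * (x i)\<^sup>2) * (\<Sum>j\<in>I. p j) + (\<Sum>i\<in>I. p i) * (\<Sum>j\<in>I. p j * (x j)\<^sup>2)
      - 2 * ((\<Sum>i\<in>I. p i * x i) * (\<Sum>j\<in>I. p j * x j))"
    by (simp only: sum_product sum.distrib sum_subtractf sum_distrib_left[symmetric, of "2::real"])
  finally show ?thesis using assms by (simp add: power2_eq_square)
qed

text \<open>Along the direction \<open>x\<close> the function is, up to an additive constant, the
  cumulant generating function of \<open>x\<close> under the softmax weights. Its first two
  derivatives at 0 are therefore the mean and the variance of \<open>x\<close>, and the third
  derivative bounds the remainder.\<close>

lemma log_sum_exp_taylor:
  fixes w x :: "'i \<Rightarrow> real"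
  assumes I: "finite I" "I \<noteq> {}" and s: "s > 0"
  defines "p \<equiv> softmax I w"
  shows "\<bar>log_sum_exp I (\<lambda>i. w i + s * x i) - (log_sum_exp I w + s * (\<Sum>i\<in>I. p i * x i)
      + s\<^sup>2 / 4 * (\<Sum>i\<in>I. \<Sum>j\<in>I. p i * p j * (x i - x j)\<^sup>2))\<bar> \<le> s ^ 3 * (\<Sum>i\<in>I. \<bar>x i\<bar>) ^ 3"
proof -
  define S where "S k t = (\<Sum>i\<in>I. x i ^ k * exp (w i + t * x i))" for k :: nat and t
  define B where "B = (\<Sum>i\<in>I. \<bar>x i\<bar>)"
  have S0: "S 0 t > 0" for t
    using sum_exp_pos[OF I] by (simp add: S_def)
  have dS: "((\<lambda>t. S k t) has_real_derivative S (Suc k) t) (at t)" for k t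
    unfolding S_def by (auto intro!: derivative_eq_intros sum.cong simp: mult_ac)
  \<comment> \<open>\<open>q k t\<close> is the \<open>k\<close>-th moment of \<open>x\<close> under
    the softmax weights of \<open>w + t * x\<close>.\<close>
  define q where "q k t = S k t / S 0 t" for k t
  have dq: "((\<lambda>t. q k t) has_real_derivative (q (Suc k) t - q k t * q 1 t)) (at t)" for k t
    unfolding q_def using S0[of t] less_imp_neq[OF S0[of t]]
    by (auto intro!: derivative_eq_intros dS simp: field_simps power2_eq_square)
  have B0: "B \<ge> 0" unfolding B_def by (simp add: sum_nonneg)
  have q: "\<bar>q k t\<bar> \<le> B ^ k" for k t
  proof -
    have xB: "\<bar>x i\<bar> \<le> B" if "i \<in> I" for i
      unfolding B_def using I that by (intro member_le_sum) auto
    have "\<bar>S k t\<bar> \<le> (\<Sum>i\<in>I. \<bar>x i ^ k * exp (w i + t * x i)\<bar>)" unfolding S_def by (rule sum_abs)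
    also have "\<dots> \<le> (\<Sum>i\<in>I. B ^ k * exp (w i + t * x i))"
      using xB by (intro sum_mono) (auto simp: abs_mult power_abs intro!: mult_right_mono power_mono)
    also have "\<dots> = B ^ k * S 0 t" by (simp add: S_def sum_distrib_left)
    finally show ?thesis using S0[of t] by (simp add: q_def field_simps)
  qed
  \<comment> \<open>The successive derivatives of \<open>ln (S 0 t)\<close>: the first three
    cumulants written in raw moments.\<close>
  define diff where "diff n = (if n = 0 then (\<lambda>t. ln (S 0 t)) else if n = 1 then q 1
      else if n = 2 then (\<lambda>t. q 2 t - (q 1 t)\<^sup>2)
      else (\<lambda>t. q 3 t - 3 * q 1 t * q 2 t + 2 * (q 1 t) ^ 3))" for n :: nat
  have "(diff 0 has_real_derivative diff (Suc 0) t) (at t)" for t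
    using S0[of t] by (auto intro!: derivative_eq_intros dS simp: diff_def q_def)
  moreover have "(diff 1 has_real_derivative diff 2 t) (at t)" for t
    using dq[of 1 t] by (simp add: diff_def power2_eq_square numeral_2_eq_2)
  moreover have "(diff 2 has_real_derivative diff 3 t) (at t)" for t
    using dq[of 1 t] dq[of 2 t]
    by (auto intro!: derivative_eq_intros simp: diff_def eval_nat_numeral algebra_simps)
  ultimately have "\<forall>m t. m < 3 \<and> 0 \<le> t \<and> t \<le> s \<longrightarrow> (diff m has_real_derivative diff (Suc m) t) (at t)"
    by (auto simp: less_Suc_eq numeral_3_eq_3 numeral_2_eq_2)
  then obtain t where t: "ln (S 0 s) = (\<Sum>m<3. diff m 0 / fact m * s ^ m) + diff 3 t / fact 3 * s ^ 3"
    using Maclaurin[OF s, of 3 diff "\<lambda>t. ln (S 0 t)"] by (auto simp: diff_def)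
  \<comment> \<open>The coefficients add up to 1 + 3 + 2 = 6, which cancels the
    \<open>fact 3\<close> of the Lagrange remainder.\<close>
  have "\<bar>diff 3 t\<bar> \<le> \<bar>q 3 t\<bar> + 3 * (\<bar>q 1 t\<bar> * \<bar>q 2 t\<bar>) + 2 * \<bar>q 1 t\<bar> ^ 3"
    unfolding diff_def by (simp add: abs_mult[symmetric] power_abs[symmetric])
  also have "\<dots> \<le> B ^ 3 + 3 * (B ^ 1 * B ^ 2) + 2 * (B ^ 1) ^ 3"
    using q[of 3 t] q[of 1 t] q[of 2 t] B0
    by (intro add_mono mult_left_mono mult_mono power_mono) auto
  finally have "\<bar>diff 3 t\<bar> \<le> 6 * B ^ 3" by (simp add: power3_eq_cube power2_eq_square)
  then have rem: "\<bar>diff 3 t / fact 3 * s ^ 3\<bar> \<le> s ^ 3 * B ^ 3"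
    using s by (simp add: abs_mult fact_numeral)
  have qp: "q k 0 = (\<Sum>i\<in>I. p i * x i ^ k)" for k
    by (simp add: q_def S_def p_def softmax_def sum_divide_distrib mult_ac)
  have "diff 2 0 = (\<Sum>i\<in>I. \<Sum>j\<in>I. p i * p j * (x i - x j)\<^sup>2) / 2"
    using variance_eq_sum_diff_squares[of p I x] sum_softmax[OF I, of w]
    by (simp add: diff_def qp p_def)
  then have "(\<Sum>m<3. diff m 0 / fact m * s ^ m) = ln (S 0 0) + s * (\<Sum>i\<in>I. p i * x i)
      + s\<^sup>2 / 4 * (\<Sum>i\<in>I. \<Sum>j\<in>I. p i * p j * (x i - x j)\<^sup>2)"
    using qp[of 1] by (simp add: eval_nat_numeral diff_def)
  with t rem show ?thesis
    by (simp add: log_sum_exp_def S_def B_def)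
qed

section \<open>The smooth maximum against the maximum, and integrability\<close>

lemma log_sum_exp_bounds:
  assumes "finite I" "I \<noteq> {}"
  shows "Max (w ` I) \<le> log_sum_exp I w" "log_sum_exp I w \<le> Max (w ` I) + ln (card I)"
proof -
  have "Max (w ` I) \<in> w ` I" using assms by (intro Max_in) auto
  then obtain k where k: "k \<in> I" "Max (w ` I) = w k" by auto
  \<comment> \<open>The sum of exponentials lies between its largest term and \<open>card I\<close>
    times that term; both bounds follow by taking logarithms.\<close>
  have "exp (w k) \<le> (\<Sum>i\<in>I. exp (w i))"
    using assms k by (intro member_le_sum) auto
  then show "Max (w ` I) \<le> log_sum_exp I w"
    using k sum_exp_pos[OF assms, of w] by (simp add: log_sum_exp_def ln_ge_iff)
  have "(\<Sum>i\<in>I. exp (w i)) \<le> (\<Sum>i\<in>I. exp (Max (w ` I)))"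
    using assms by (intro sum_mono) auto
  then have "log_sum_exp I w \<le> ln (card I * exp (Max (w ` I)))"
    using sum_exp_pos[OF assms, of w] by (simp add: log_sum_exp_def)
  also have "\<dots> = Max (w ` I) + ln (card I)"
    using assms by (simp add: ln_mult card_gt_0_iff)
  finally show "log_sum_exp I w \<le> Max (w ` I) + ln (card I)" .
qed

lemma abs_Max_le_sum:
  fixes w :: "'i \<Rightarrow> real"
  assumes "finite I" "I \<noteq> {}"
  shows "\<bar>Max (w ` I)\<bar> \<le> (\<Sum>i\<in>I. \<bar>w i\<bar>)"
proof -
  have "Max (w ` I) \<in> w ` I" using assms by (intro Max_in) auto
  then obtain k where k: "k \<in> I" "Max (w ` I) = w k" by auto
  then show ?thesis using assms by (auto intro!: member_le_sum)
qed

lemma borel_measurable_log_sum_exp: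
  assumes "\<And>i. i \<in> I \<Longrightarrow> W i \<in> borel_measurable M"
  shows "(\<lambda>\<omega>. log_sum_exp I (\<lambda>i. W i \<omega>)) \<in> borel_measurable M"
  unfolding log_sum_exp_def using assms by (intro borel_measurable_ln borel_measurable_sum borel_measurable_exp) auto

lemma (in prob_space) integrable_log_sum_exp:
  assumes "finite I" "I \<noteq> {}" "\<And>i. i \<in> I \<Longrightarrow> integrable M (W i)"
  shows "integrable M (\<lambda>\<omega>. log_sum_exp I (\<lambda>i. W i \<omega>))"
proof (rule Bochner_Integration.integrable_bound)
  show "integrable M (\<lambda>\<omega>. (\<Sum>i\<in>I. \<bar>W i \<omega>\<bar>) + ln (card I))"
    using assms by (intro Bochner_Integration.integrable_add Bochner_Integration.integrable_sum integrable_abs) auto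
  show "(\<lambda>\<omega>. log_sum_exp I (\<lambda>i. W i \<omega>)) \<in> borel_measurable M"
    using assms(3) by (intro borel_measurable_log_sum_exp) auto
  have ln: "0 \<le> ln (card I)" using assms(1,2) by (simp add: Suc_leI card_gt_0_iff)
  show "AE \<omega> in M. norm (log_sum_exp I (\<lambda>i. W i \<omega>)) \<le> norm ((\<Sum>i\<in>I. \<bar>W i \<omega>\<bar>) + ln (card I))"
  proof (rule AE_I2)
    fix \<omega>
    show "norm (log_sum_exp I (\<lambda>i. W i \<omega>)) \<le> norm ((\<Sum>i\<in>I. \<bar>W i \<omega>\<bar>) + ln (card I))"
      using log_sum_exp_bounds[OF assms(1,2), of "\<lambda>i. W i \<omega>"] abs_Max_le_sum[OF assms(1,2), of "\<lambda>i. W i \<omega>"] ln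
      by (simp add: sum_nonneg)
  qed
qed

text \<open>Each summand is at most the largest one, whose cube occurs on the right. The bound turns
  the Taylor remainder into third moments of single variables.\<close>

lemma sum_abs_cubed_le:
  fixes x :: "'i \<Rightarrow> real"
  assumes "finite I"
  shows "(\<Sum>i\<in>I. \<bar>x i\<bar>) ^ 3 \<le> real (card I) ^ 3 * (\<Sum>i\<in>I. \<bar>x i\<bar> ^ 3)"
proof (cases "I = {}")
  case False
  have "Max ((\<lambda>i. \<bar>x i\<bar>) ` I) \<in> (\<lambda>i. \<bar>x i\<bar>) ` I" using assms False by (intro Max_in) auto
  then obtain k where k: "k \<in> I" "Max ((\<lambda>i. \<bar>x i\<bar>) ` I) = \<bar>x k\<bar>" by auto
  have "(\<Sum>i\<in>I. \<bar>x i\<bar>) \<le> (\<Sum>i\<in>I. \<bar>x k\<bar>)"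
    using assms False by (intro sum_mono) (auto simp flip: k(2))
  then have "(\<Sum>i\<in>I. \<bar>x i\<bar>) ^ 3 \<le> (real (card I) * \<bar>x k\<bar>) ^ 3"
    by (intro power_mono) (auto simp: sum_nonneg)
  also have "\<dots> \<le> real (card I) ^ 3 * (\<Sum>i\<in>I. \<bar>x i\<bar> ^ 3)"
    using assms k(1) member_le_sum[of k I "\<lambda>i. \<bar>x i\<bar> ^ 3"]
    by (auto simp: power_mult_distrib intro!: mult_left_mono)
  finally show ?thesis .
qed simp

section \<open>Closure properties of Gaussian processes and expectations of the expansion\<close>

lemma centered_gaussian_process_diff:
  assumes "centered_gaussian_process M I X" "i \<in> I" "j \<in> I"
  shows "centered_gaussian M (\<lambda>\<omega>. X i \<omega> - X j \<omega>)"
\<comment> \<open>For \<open>i = j\<close> the set \<open>{i, j}\<close> collapses and the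
  coefficients 1 and -1 no longer give the difference; the variable is then constantly 0, a
  degenerate Gaussian.\<close>
proof (cases "i = j")
  case True
  then show ?thesis by (simp add: centered_gaussian_def)
next
  case False
  then show ?thesis
    using centered_gaussian_process_lincomb[OF assms(1), of "{i, j}" "\<lambda>k. if k = i then 1 else -1"] assms(2,3)
    by simp
qed

lemma centered_gaussian_process_scale:
  assumes "centered_gaussian_process M I X"
  shows "centered_gaussian_process M I (\<lambda>i \<omega>. b * X i \<omega>)"
  unfolding centered_gaussian_process_def
proof (intro conjI allI impI)
  show "prob_space M" using assms by (simp add: centered_gaussian_process_def)
  fix F c assume "finite F \<and> F \<subseteq> I"
  then have "centered_gaussian M (\<lambda>\<omega>. \<Sum>i\<in>F. (c i * b) * X i \<omega>)"
    using assms by (intro centered_gaussian_process_lincomb) auto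
  then show "centered_gaussian M (\<lambda>\<omega>. \<Sum>i\<in>F. c i * (b * X i \<omega>))"
    by (simp add: mult.assoc)
qed

lemma centered_gaussian_process_subset:
  assumes "centered_gaussian_process M I X" "J \<subseteq> I"
  shows "centered_gaussian_process M J X"
  using assms unfolding centered_gaussian_process_def by (meson subset_trans)

lemma integrable_comp_fst:
  fixes f :: "'a \<Rightarrow> real"
  assumes "prob_space N" "integrable M f"
  shows "integrable (M \<Otimes>\<^sub>M N) (\<lambda>\<omega>. f (fst \<omega>))"
  using integrable_distr[of fst "M \<Otimes>\<^sub>M N" M f] prob_space.distr_pair_fst[OF assms(1), of M] assms(2) by simp

lemma integrable_comp_snd:
  fixes f :: "'b \<Rightarrow> real"
  assumes "prob_space M" "prob_space N" "integrable N f"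
  shows "integrable (M \<Otimes>\<^sub>M N) (\<lambda>\<omega>. f (snd \<omega>))"
proof -
  interpret M: prob_space M by fact
  interpret N: prob_space N by fact
  interpret NM: pair_prob_space N M ..
  show ?thesis
    using NM.integrable_product_swap[OF integrable_comp_fst[OF assms(1,3)]] by (simp add: case_prod_unfold)
qed

text \<open>In the expansion around the fixed point \<open>w\<close> the first-order term has mean
  zero by centering. What survives is the second-order term in the increment variances and a
  remainder governed by third absolute moments.\<close>

lemma expectation_log_sum_exp_taylor:
  assumes X: "centered_gaussian_process M I X" and I: "finite I" "I \<noteq> {}" and s: "s > 0"
  shows "\<bar>(\<integral>\<omega>. log_sum_exp I (\<lambda>i. w i + s * X i \<omega>) \<partial>M) - (log_sum_exp I w
      + s\<^sup>2 / 4 * (\<Sum>i\<in>I. \<Sum>j\<in>I. softmax I w i * softmax I w j * (\<integral>\<omega>. (X i \<omega> - X j \<omega>)\<^sup>2 \<partial>M)))\<bar>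
    \<le> s ^ 3 * (real (card I) ^ 3 * (\<Sum>i\<in>I. \<integral>\<omega>. \<bar>X i \<omega>\<bar> ^ 3 \<partial>M))"
proof -
  interpret prob_space M using X by (simp add: centered_gaussian_process_def)
  let ?p = "softmax I w"
  note comp = centered_gaussian_process_component[OF X]
  have int1: "integrable M (X i)" and zero: "(\<integral>\<omega>. X i \<omega> \<partial>M) = 0"
    and int3: "integrable M (\<lambda>\<omega>. \<bar>X i \<omega>\<bar> ^ 3)" if "i \<in> I" for i
    using centered_gaussian_integrable[OF comp[OF that]]
      centered_gaussian_moments[OF prob_space_axioms comp[OF that]] by auto
  have int2: "integrable M (\<lambda>\<omega>. (X i \<omega> - X j \<omega>)\<^sup>2)" if "i \<in> I" "j \<in> I" for i j
    using centered_gaussian_moments(2)[OF prob_space_axioms centered_gaussian_process_diff[OF X that]] .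
  define T where "T \<omega> = log_sum_exp I w + s * (\<Sum>i\<in>I. ?p i * X i \<omega>)
      + s\<^sup>2 / 4 * (\<Sum>i\<in>I. \<Sum>j\<in>I. ?p i * ?p j * (X i \<omega> - X j \<omega>)\<^sup>2)" for \<omega>
  have intT: "integrable M T"
    unfolding T_def
    by (intro Bochner_Integration.integrable_add integrable_mult_right Bochner_Integration.integrable_sum int1 int2) auto
  have ET: "(\<integral>\<omega>. T \<omega> \<partial>M) = log_sum_exp I w
      + s\<^sup>2 / 4 * (\<Sum>i\<in>I. \<Sum>j\<in>I. ?p i * ?p j * (\<integral>\<omega>. (X i \<omega> - X j \<omega>)\<^sup>2 \<partial>M))"
    unfolding T_def using int1 int2 zero
    by (simp add: prob_space Bochner_Integration.integrable_sum)
  have intL: "integrable M (\<lambda>\<omega>. log_sum_exp I (\<lambda>i. w i + s * X i \<omega>))"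
    using I int1 by (intro integrable_log_sum_exp) auto
  have "\<bar>(\<integral>\<omega>. log_sum_exp I (\<lambda>i. w i + s * X i \<omega>) \<partial>M) - (\<integral>\<omega>. T \<omega> \<partial>M)\<bar>
      = \<bar>\<integral>\<omega>. log_sum_exp I (\<lambda>i. w i + s * X i \<omega>) - T \<omega> \<partial>M\<bar>"
    using intL intT by simp
  also have "\<dots> \<le> (\<integral>\<omega>. \<bar>log_sum_exp I (\<lambda>i. w i + s * X i \<omega>) - T \<omega>\<bar> \<partial>M)"
    by (rule integral_abs_bound)
  also have "\<dots> \<le> (\<integral>\<omega>. s ^ 3 * (real (card I) ^ 3 * (\<Sum>i\<in>I. \<bar>X i \<omega>\<bar> ^ 3)) \<partial>M)"
  proof (rule integral_mono)
    show "\<bar>log_sum_exp I (\<lambda>i. w i + s * X i \<omega>) - T \<omega>\<bar> \<le> s ^ 3 * (real (card I) ^ 3 * (\<Sum>i\<in>I. \<bar>X i \<omega>\<bar> ^ 3))" for \<omega>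
      unfolding T_def using s
      by (intro order_trans[OF log_sum_exp_taylor[OF I s]] mult_left_mono sum_abs_cubed_le I) simp
  qed (use intL intT int3 in auto)
  also have "\<dots> = s ^ 3 * (real (card I) ^ 3 * (\<Sum>i\<in>I. \<integral>\<omega>. \<bar>X i \<omega>\<bar> ^ 3 \<partial>M))"
    using int3 by simp
  finally show ?thesis unfolding ET .
qed

subsection \<open>Replacement, step by step\<close>

text \<open>By Fubini the common part \<open>W\<close> may be frozen at a value \<open>w\<close>.
  The two expansions then share their constant term, and their second-order terms are ordered by
  \<open>le\<close> because the softmax weights are nonnegative; \<open>?R\<close> collects both
  remainders.\<close>

lemma log_sum_exp_replacement:
  assumes X: "centered_gaussian_process M I X" and Y: "centered_gaussian_process N I Y"
    and le: "\<And>i j. i \<in> I \<Longrightarrow> j \<in> I \<Longrightarrow>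
           (\<integral>\<omega>. (X i \<omega> - X j \<omega>)\<^sup>2 \<partial>M) \<le> (\<integral>\<omega>. (Y i \<omega> - Y j \<omega>)\<^sup>2 \<partial>N)"
    and I: "finite I" "I \<noteq> {}" and s: "s > 0"
    and P: "prob_space P" "\<And>i. i \<in> I \<Longrightarrow> integrable P (W i)"
  shows "(\<integral>\<omega>. log_sum_exp I (\<lambda>i. W i (fst \<omega>) + s * X i (snd \<omega>)) \<partial>(P \<Otimes>\<^sub>M M))
      \<le> (\<integral>\<omega>. log_sum_exp I (\<lambda>i. W i (fst \<omega>) + s * Y i (snd \<omega>)) \<partial>(P \<Otimes>\<^sub>M N))
        + s ^ 3 * (real (card I) ^ 3 * ((\<Sum>i\<in>I. \<integral>\<omega>. \<bar>X i \<omega>\<bar> ^ 3 \<partial>M) + (\<Sum>i\<in>I. \<integral>\<omega>. \<bar>Y i \<omega>\<bar> ^ 3 \<partial>N)))"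
    (is "_ \<le> _ + ?R")
proof -
  interpret M: prob_space M using X by (simp add: centered_gaussian_process_def)
  interpret N: prob_space N using Y by (simp add: centered_gaussian_process_def)
  interpret P: prob_space P by fact
  interpret PM: pair_prob_space P M ..
  interpret PN: pair_prob_space P N ..
  have intX: "integrable (P \<Otimes>\<^sub>M M) (\<lambda>\<omega>. log_sum_exp I (\<lambda>i. W i (fst \<omega>) + s * X i (snd \<omega>)))"
    using I P(2) centered_gaussian_integrable[OF centered_gaussian_process_component[OF X]]
    by (intro PM.integrable_log_sum_exp Bochner_Integration.integrable_add integrable_mult_right integrable_comp_fst integrable_comp_snd
        P.prob_space_axioms M.prob_space_axioms N.prob_space_axioms)
  have intY: "integrable (P \<Otimes>\<^sub>M N) (\<lambda>\<omega>. log_sum_exp I (\<lambda>i. W i (fst \<omega>) + s * Y i (snd \<omega>)))"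
    using I P(2) centered_gaussian_integrable[OF centered_gaussian_process_component[OF Y]]
    by (intro PN.integrable_log_sum_exp Bochner_Integration.integrable_add integrable_mult_right integrable_comp_fst integrable_comp_snd
        P.prob_space_axioms M.prob_space_axioms N.prob_space_axioms)
  have pointwise: "(\<integral>y. log_sum_exp I (\<lambda>i. w i + s * X i y) \<partial>M) \<le> (\<integral>y. log_sum_exp I (\<lambda>i. w i + s * Y i y) \<partial>N) + ?R" for w
  proof -
    have "s\<^sup>2 / 4 * (\<Sum>i\<in>I. \<Sum>j\<in>I. softmax I w i * softmax I w j * (\<integral>\<omega>. (X i \<omega> - X j \<omega>)\<^sup>2 \<partial>M))
        \<le> s\<^sup>2 / 4 * (\<Sum>i\<in>I. \<Sum>j\<in>I. softmax I w i * softmax I w j * (\<integral>\<omega>. (Y i \<omega> - Y j \<omega>)\<^sup>2 \<partial>N))"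
      using le by (intro mult_left_mono sum_mono) (auto simp: softmax_nonneg)
    then show ?thesis
      using expectation_log_sum_exp_taylor[OF X I s, of w] expectation_log_sum_exp_taylor[OF Y I s, of w]
      by (simp add: algebra_simps abs_le_iff)
  qed
  have "(\<integral>\<omega>. log_sum_exp I (\<lambda>i. W i (fst \<omega>) + s * X i (snd \<omega>)) \<partial>(P \<Otimes>\<^sub>M M))
      = (\<integral>x. (\<integral>y. log_sum_exp I (\<lambda>i. W i x + s * X i y) \<partial>M) \<partial>P)"
    using PM.integral_fst'[OF intX] by simp
  also have "\<dots> \<le> (\<integral>x. (\<integral>y. log_sum_exp I (\<lambda>i. W i x + s * Y i y) \<partial>N) + ?R \<partial>P)"
    using PM.integrable_fst'[OF intX] PN.integrable_fst'[OF intY] pointwise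
    by (intro integral_mono) auto
  also have "\<dots> = (\<integral>x. (\<integral>y. log_sum_exp I (\<lambda>i. W i x + s * Y i y) \<partial>N) \<partial>P) + ?R"
    using PN.integrable_fst'[OF intY] by (simp add: P.prob_space)
  also have "(\<integral>x. (\<integral>y. log_sum_exp I (\<lambda>i. W i x + s * Y i y) \<partial>N) \<partial>P)
      = (\<integral>\<omega>. log_sum_exp I (\<lambda>i. W i (fst \<omega>) + s * Y i (snd \<omega>)) \<partial>(P \<Otimes>\<^sub>M N))"
    using PN.integral_fst'[OF intY] by simp
  finally show ?thesis .
qed

lemma gaussian_family_log_sum_exp_eq:
  fixes X :: "'i \<Rightarrow> 'a \<Rightarrow> real" and Y :: "'i \<Rightarrow> 'b \<Rightarrow> real"
  assumes "gaussian_family M I X V" "gaussian_family N I Y V" "finite I"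
  shows "(\<integral>\<omega>. log_sum_exp I (\<lambda>i. m i + X i \<omega>) \<partial>M) = (\<integral>\<omega>. log_sum_exp I (\<lambda>i. m i + Y i \<omega>) \<partial>N)"
proof -
  have "(\<lambda>x. log_sum_exp I (\<lambda>i. m i + x i)) \<in> borel_measurable (PiM I (\<lambda>_. borel))"
    by (intro borel_measurable_log_sum_exp borel_measurable_add) auto
  from gaussian_family_integral_eq[OF assms this] show ?thesis
    by (simp add: log_sum_exp_def)
qed

text \<open>The chain \<open>a 0\<close>, ..., \<open>a n\<close> leads from \<open>X\<close> to
  \<open>Y\<close>. Each link costs at most \<open>s ^ 3 * ?K\<close> with
  \<open>s = 1 / sqrt n\<close>, and \<open>n\<close> such errors add up to
  \<open>?K / sqrt n\<close>.\<close>

lemma expectation_log_sum_exp_comparison_steps: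
  assumes X: "centered_gaussian_process M I X" and Y: "centered_gaussian_process N I Y"
    and le: "\<And>i j. i \<in> I \<Longrightarrow> j \<in> I \<Longrightarrow>
           (\<integral>\<omega>. (X i \<omega> - X j \<omega>)\<^sup>2 \<partial>M) \<le> (\<integral>\<omega>. (Y i \<omega> - Y j \<omega>)\<^sup>2 \<partial>N)"
    and I: "finite I" "I \<noteq> {}" and n: "n > 0"
  shows "(\<integral>\<omega>. log_sum_exp I (\<lambda>i. m i + X i \<omega>) \<partial>M)
      \<le> (\<integral>\<omega>. log_sum_exp I (\<lambda>i. m i + Y i \<omega>) \<partial>N)
        + (real (card I) ^ 3 * ((\<Sum>i\<in>I. \<integral>\<omega>. \<bar>X i \<omega>\<bar> ^ 3 \<partial>M) + (\<Sum>i\<in>I. \<integral>\<omega>. \<bar>Y i \<omega>\<bar> ^ 3 \<partial>N))) / sqrt (real n)"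
    (is "_ \<le> _ + ?K / _")
proof -
  interpret M: prob_space M using X by (simp add: centered_gaussian_process_def)
  interpret N: prob_space N using Y by (simp add: centered_gaussian_process_def)
  interpret MN: pair_prob_space M N ..
  define VX where "VX c = (\<integral>\<omega>. (\<Sum>i\<in>I. c i * X i \<omega>)\<^sup>2 \<partial>M)" for c
  define VY where "VY c = (\<integral>\<omega>. (\<Sum>i\<in>I. c i * Y i \<omega>)\<^sup>2 \<partial>N)" for c
  have GX: "gaussian_family M I X VX" and GY: "gaussian_family N I Y VY"
    using gaussian_family_process[OF X I(1)] gaussian_family_process[OF Y I(1)]
    by (simp_all add: VX_def[abs_def] VY_def[abs_def])
  have homX: "VX (\<lambda>i. a * c i) = a\<^sup>2 * VX c" and homY: "VY (\<lambda>i. a * c i) = a\<^sup>2 * VY c" for a c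
    by (simp_all add: VX_def VY_def mult.assoc sum_distrib_left[symmetric] power_mult_distrib)
  note sX = gaussian_family_scale[OF GX homX] and sY = gaussian_family_scale[OF GY homY]
  define Z where "Z u v i \<omega> = sqrt u * X i (fst \<omega>) + sqrt v * Y i (snd \<omega>)" for u v i \<omega>
  have GZ: "gaussian_family (M \<Otimes>\<^sub>M N) I (Z u v) (\<lambda>c. u * VX c + v * VY c)" if "u \<ge> 0" "v \<ge> 0" for u v
    using gaussian_family_add[OF sX[of "sqrt u"] sY[of "sqrt v"]] that by (simp add: Z_def[abs_def])
  have intZ: "integrable (M \<Otimes>\<^sub>M N) (\<lambda>\<omega>. m i + Z u v i \<omega>)" if "i \<in> I" for u v i
    unfolding Z_def
    using centered_gaussian_integrable[OF centered_gaussian_process_component[OF X that]]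
      centered_gaussian_integrable[OF centered_gaussian_process_component[OF Y that]]
    by (intro Bochner_Integration.integrable_add integrable_mult_right integrable_comp_fst integrable_comp_snd
        M.prob_space_axioms N.prob_space_axioms) auto
  define a where "a k = (\<integral>\<omega>. log_sum_exp I (\<lambda>i. m i + Z (1 - k / n) (k / n) i \<omega>) \<partial>(M \<Otimes>\<^sub>M N))" for k :: nat
  define s where "s = sqrt (1 / n)"
  have s: "s > 0" "s\<^sup>2 = 1 / n" using n by (simp_all add: s_def)
  have step: "a k \<le> a (Suc k) + s ^ 3 * ?K" if "k < n" for k
  proof -
    \<comment> \<open>The part common to stages \<open>k\<close> and \<open>Suc k\<close>: an
      independent copy of \<open>s * X\<close> completes it to the law of stage \<open>k\<close>,
      one of \<open>s * Y\<close> to that of stage \<open>Suc k\<close>, since \<open>s\<close>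
      squared is \<open>1 / n\<close>.\<close>
    let ?u = "1 - Suc k / n" and ?v = "k / n"
    have uv: "?u \<ge> 0" "?v \<ge> 0" using that n by (simp_all add: field_simps)
    have "gaussian_family ((M \<Otimes>\<^sub>M N) \<Otimes>\<^sub>M N) I (\<lambda>i \<omega>. Z ?u ?v i (fst \<omega>) + s * Y i (snd \<omega>))
        (\<lambda>c. (1 - Suc k / n) * VX c + Suc k / n * VY c)"
    proof -
      have "?u * VX c + ?v * VY c + s\<^sup>2 * VY c = (1 - Suc k / n) * VX c + Suc k / n * VY c" for c
        by (simp add: s add_divide_distrib algebra_simps)
      then show ?thesis using gaussian_family_add[OF GZ[OF uv] sY[of s]] by (simp only:)
    qed
    from gaussian_family_log_sum_exp_eq[OF GZ this I(1), of m] uv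
    have Suc: "a (Suc k) = (\<integral>\<omega>. log_sum_exp I (\<lambda>i. m i + (Z ?u ?v i (fst \<omega>) + s * Y i (snd \<omega>))) \<partial>((M \<Otimes>\<^sub>M N) \<Otimes>\<^sub>M N))"
      by (simp add: a_def)
    have "gaussian_family ((M \<Otimes>\<^sub>M N) \<Otimes>\<^sub>M M) I (\<lambda>i \<omega>. Z ?u ?v i (fst \<omega>) + s * X i (snd \<omega>))
        (\<lambda>c. (1 - k / n) * VX c + k / n * VY c)"
      using gaussian_family_add[OF GZ[OF uv] sX[of s]] n by (simp add: s field_simps)
    from gaussian_family_log_sum_exp_eq[OF GZ this I(1), of m] that
    have "a k = (\<integral>\<omega>. log_sum_exp I (\<lambda>i. m i + (Z ?u ?v i (fst \<omega>) + s * X i (snd \<omega>))) \<partial>((M \<Otimes>\<^sub>M N) \<Otimes>\<^sub>M M))"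
      by (simp add: a_def)
    also have "\<dots> \<le> (\<integral>\<omega>. log_sum_exp I (\<lambda>i. m i + (Z ?u ?v i (fst \<omega>) + s * Y i (snd \<omega>))) \<partial>((M \<Otimes>\<^sub>M N) \<Otimes>\<^sub>M N)) + s ^ 3 * ?K"
      using log_sum_exp_replacement[OF X Y le I s(1) MN.prob_space_axioms, of "\<lambda>i \<omega>. m i + Z ?u ?v i \<omega>"] intZ
      by (simp add: add.assoc)
    finally show ?thesis unfolding Suc .
  qed
  have "a 0 \<le> a k + k * (s ^ 3 * ?K)" if "k \<le> n" for k
    using that
  proof (induction k)
    case (Suc k)
    then show ?case using step[of k] by (simp add: algebra_simps)
  qed simp
  from this[of n] have "a 0 \<le> a n + n * (s ^ 3 * ?K)" by simp
  also have "n * (s ^ 3 * ?K) = ?K / sqrt n"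
    using n s(2) by (simp add: power3_eq_cube power2_eq_square s_def real_sqrt_divide)
  \<comment> \<open>At the two ends one of the weights vanishes, so \<open>Z\<close> has the law of
    \<open>X\<close> or of \<open>Y\<close> although it lives on the product space.\<close>
  also have "a 0 = (\<integral>\<omega>. log_sum_exp I (\<lambda>i. m i + X i \<omega>) \<partial>M)"
    using gaussian_family_log_sum_exp_eq[OF GZ[of 1 0] _ I(1)] GX by (simp add: a_def)
  also have "a n = (\<integral>\<omega>. log_sum_exp I (\<lambda>i. m i + Y i \<omega>) \<partial>N)"
    using gaussian_family_log_sum_exp_eq[OF GZ[of 0 1] _ I(1)] GY n by (simp add: a_def)
  finally show ?thesis .
qed

lemma expectation_log_sum_exp_comparison:
  assumes X: "centered_gaussian_process M I X" and Y: "centered_gaussian_process N I Y"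
    and le: "\<And>i j. i \<in> I \<Longrightarrow> j \<in> I \<Longrightarrow>
           (\<integral>\<omega>. (X i \<omega> - X j \<omega>)\<^sup>2 \<partial>M) \<le> (\<integral>\<omega>. (Y i \<omega> - Y j \<omega>)\<^sup>2 \<partial>N)"
    and I: "finite I" "I \<noteq> {}"
  shows "(\<integral>\<omega>. log_sum_exp I (\<lambda>i. m i + X i \<omega>) \<partial>M) \<le> (\<integral>\<omega>. log_sum_exp I (\<lambda>i. m i + Y i \<omega>) \<partial>N)"
proof (rule LIMSEQ_le_const)
  let ?b = "\<integral>\<omega>. log_sum_exp I (\<lambda>i. m i + Y i \<omega>) \<partial>N"
  let ?K = "real (card I) ^ 3 * ((\<Sum>i\<in>I. \<integral>\<omega>. \<bar>X i \<omega>\<bar> ^ 3 \<partial>M) + (\<Sum>i\<in>I. \<integral>\<omega>. \<bar>Y i \<omega>\<bar> ^ 3 \<partial>N))"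
  have "(\<lambda>n. K / sqrt (real n)) \<longlonglongrightarrow> 0" for K
    by (intro real_tendsto_divide_at_top[OF tendsto_const]
        filterlim_compose[OF sqrt_at_top filterlim_real_sequentially])
  from tendsto_add[OF tendsto_const[of ?b] this[of ?K]]
  show "(\<lambda>n. ?b + ?K / sqrt (real n)) \<longlonglongrightarrow> ?b" by simp
  show "\<exists>n0. \<forall>n\<ge>n0. (\<integral>\<omega>. log_sum_exp I (\<lambda>i. m i + X i \<omega>) \<partial>M) \<le> ?b + ?K / sqrt (real n)"
    \<comment> \<open>The stepwise bound requires \<open>n > 0\<close>, hence the threshold
      1.\<close>
    using expectation_log_sum_exp_comparison_steps[OF X Y le I] by (intro exI[of _ 1]) simp
qed

section \<open>From the smooth maximum to the maximum\<close>

lemma (in prob_space) integrable_Max: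
  fixes W :: "'i \<Rightarrow> 'a \<Rightarrow> real"
  assumes "finite I" "I \<noteq> {}" "\<And>i. i \<in> I \<Longrightarrow> integrable M (W i)"
  shows "integrable M (\<lambda>\<omega>. Max ((\<lambda>i. W i \<omega>) ` I))"
  using assms
proof (induction I rule: finite_ne_induct)
  case (insert i I)
  then have "integrable M (\<lambda>\<omega>. max (W i \<omega>) (Max ((\<lambda>i. W i \<omega>) ` I)))"
    by (intro integrable_max) auto
  with insert.hyps show ?case by simp
qed simp

text \<open>The gap \<open>ln (card I)\<close> does not grow with \<open>b\<close>, so after
  division by \<open>b\<close> it becomes arbitrarily small.\<close>

lemma log_sum_exp_scaled_bounds:
  fixes x m :: "'i \<Rightarrow> real"
  assumes "finite I" "I \<noteq> {}" "b > 0"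
  shows "b * Max ((\<lambda>i. x i + m i) ` I) \<le> log_sum_exp I (\<lambda>i. b * m i + b * x i)"
    and "log_sum_exp I (\<lambda>i. b * m i + b * x i) \<le> b * Max ((\<lambda>i. x i + m i) ` I) + ln (card I)"
proof -
  have "mono ((*) b)" using assms(3) by (intro monoI mult_left_mono) auto
  from mono_Max_commute[OF this, of "(\<lambda>i. x i + m i) ` I"]
  have "b * Max ((\<lambda>i. x i + m i) ` I) = Max ((\<lambda>i. b * m i + b * x i) ` I)"
    using assms by (simp add: image_image algebra_simps)
  then show "b * Max ((\<lambda>i. x i + m i) ` I) \<le> log_sum_exp I (\<lambda>i. b * m i + b * x i)"
    "log_sum_exp I (\<lambda>i. b * m i + b * x i) \<le> b * Max ((\<lambda>i. x i + m i) ` I) + ln (card I)"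
    using log_sum_exp_bounds[OF assms(1,2), of "\<lambda>i. b * m i + b * x i"] by simp_all
qed

lemma integrable_Max_process:
  assumes X: "centered_gaussian_process M I X" and I: "finite I" "I \<noteq> {}"
  shows "integrable M (\<lambda>\<omega>. Max ((\<lambda>i. X i \<omega> + m i) ` I))"
proof -
  interpret prob_space M using X by (simp add: centered_gaussian_process_def)
  show ?thesis
    using I centered_gaussian_integrable[OF centered_gaussian_process_component[OF X]]
    by (intro integrable_Max Bochner_Integration.integrable_add) auto
qed

text \<open>Scaling both processes by \<open>b\<close> multiplies all increment variances by the
  same factor, so the smooth comparison applies to the scaled processes and yields the claim up to
  \<open>ln (card I) / b\<close>.\<close>

lemma expectation_Max_comparison:
  assumes X: "centered_gaussian_process M I X" and Y: "centered_gaussian_process N I Y"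
    and le: "\<And>i j. i \<in> I \<Longrightarrow> j \<in> I \<Longrightarrow>
           (\<integral>\<omega>. (X i \<omega> - X j \<omega>)\<^sup>2 \<partial>M) \<le> (\<integral>\<omega>. (Y i \<omega> - Y j \<omega>)\<^sup>2 \<partial>N)"
    and I: "finite I" "I \<noteq> {}"
  shows "(\<integral>\<omega>. Max ((\<lambda>i. X i \<omega> + m i) ` I) \<partial>M) \<le> (\<integral>\<omega>. Max ((\<lambda>i. Y i \<omega> + m i) ` I) \<partial>N)"
    (is "?a \<le> ?b")
proof (rule field_le_epsilon)
  interpret M: prob_space M using X by (simp add: centered_gaussian_process_def)
  interpret N: prob_space N using Y by (simp add: centered_gaussian_process_def)
  fix e :: real assume e: "e > 0"
  \<comment> \<open>Chosen so that \<open>b * e\<close> exceeds \<open>ln (card I)\<close>; the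
    summand 1 keeps \<open>b\<close> positive when \<open>I\<close> is a singleton.\<close>
  define b where "b = (ln (card I) + 1) / e"
  have "0 \<le> ln (card I)" using I by (simp add: Suc_leI card_gt_0_iff)
  then have b: "b > 0" using e by (simp add: b_def)
  note X' = centered_gaussian_process_scale[OF X, of b] and Y' = centered_gaussian_process_scale[OF Y, of b]
  have "b * ?a = (\<integral>\<omega>. b * Max ((\<lambda>i. X i \<omega> + m i) ` I) \<partial>M)" by simp
  also have "\<dots> \<le> (\<integral>\<omega>. log_sum_exp I (\<lambda>i. b * m i + b * X i \<omega>) \<partial>M)"
    using I integrable_Max_process[OF X I] log_sum_exp_scaled_bounds(1)[OF I b]
      centered_gaussian_integrable[OF centered_gaussian_process_component[OF X']]
    by (intro integral_mono M.integrable_log_sum_exp integrable_mult_right Bochner_Integration.integrable_add) auto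
  also have "\<dots> \<le> (\<integral>\<omega>. log_sum_exp I (\<lambda>i. b * m i + b * Y i \<omega>) \<partial>N)"
  proof (rule expectation_log_sum_exp_comparison[OF X' Y' _ I])
    fix i j assume "i \<in> I" "j \<in> I"
    then show "(\<integral>\<omega>. (b * X i \<omega> - b * X j \<omega>)\<^sup>2 \<partial>M) \<le> (\<integral>\<omega>. (b * Y i \<omega> - b * Y j \<omega>)\<^sup>2 \<partial>N)"
      using le[of i j] by (simp add: right_diff_distrib[symmetric] power_mult_distrib mult_left_mono)
  qed
  also have "\<dots> \<le> (\<integral>\<omega>. b * Max ((\<lambda>i. Y i \<omega> + m i) ` I) + ln (card I) \<partial>N)"
    using I integrable_Max_process[OF Y I] log_sum_exp_scaled_bounds(2)[OF I b]
      centered_gaussian_integrable[OF centered_gaussian_process_component[OF Y']]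
    by (intro integral_mono N.integrable_log_sum_exp integrable_mult_right Bochner_Integration.integrable_add) auto
  also have "\<dots> = b * ?b + ln (card I)"
    using integrable_Max_process[OF Y I] by (simp add: N.prob_space)
  also have "\<dots> \<le> b * (?b + e)" using e by (simp add: b_def field_simps)
  finally show "?a \<le> ?b + e" using b by simp
qed

subsection \<open>Passage to countable index sets\<close>

text \<open>Positive parts increase, so monotone convergence applies. Negative parts decrease and
  are dominated by that of \<open>f 0\<close>, whose integral is finite.\<close>

lemma ereal_expectation_incseq:
  assumes [measurable]: "\<And>n. f n \<in> borel_measurable M" and inc: "\<And>\<omega>. incseq (\<lambda>n. f n \<omega>)"
    and fin: "(\<integral>\<^sup>+ \<omega>. e2ennreal (- f 0 \<omega>) \<partial>M) < \<infinity>"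
  shows "(\<lambda>n. ereal_expectation M (f n)) \<longlonglongrightarrow> ereal_expectation M (\<lambda>\<omega>. SUP n. f n \<omega>)"
proof -
  have lim: "(\<lambda>n. f n \<omega>) \<longlonglongrightarrow> (SUP n. f n \<omega>)" for \<omega>
    using inc by (rule LIMSEQ_SUP)
  have pos: "(\<lambda>n. \<integral>\<^sup>+ \<omega>. e2ennreal (f n \<omega>) \<partial>M) \<longlonglongrightarrow> (\<integral>\<^sup>+ \<omega>. e2ennreal (SUP n. f n \<omega>) \<partial>M)"
    using inc by (intro nn_integral_LIMSEQ tendsto_intros lim) (auto simp: incseq_def le_fun_def intro!: e2ennreal_mono)
  have neg: "(\<lambda>n. \<integral>\<^sup>+ \<omega>. e2ennreal (- f n \<omega>) \<partial>M) \<longlonglongrightarrow> (\<integral>\<^sup>+ \<omega>. e2ennreal (- (SUP n. f n \<omega>)) \<partial>M)"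
  proof (rule nn_integral_dominated_convergence[OF _ _ _ _ fin])
    show "AE \<omega> in M. e2ennreal (- f n \<omega>) \<le> e2ennreal (- f 0 \<omega>)" for n
      using inc by (auto intro!: e2ennreal_mono simp: incseq_def)
    show "AE \<omega> in M. (\<lambda>n. e2ennreal (- f n \<omega>)) \<longlonglongrightarrow> e2ennreal (- (SUP n. f n \<omega>))"
      by (intro AE_I2 tendsto_e2ennrealI tendsto_uminus_ereal lim)
  qed simp_all
  \<comment> \<open>A finite limit of the negative parts rules out an indeterminate difference of
    infinities when the two limits are subtracted.\<close>
  have "(\<integral>\<^sup>+ \<omega>. e2ennreal (- (SUP n. f n \<omega>)) \<partial>M) \<le> (\<integral>\<^sup>+ \<omega>. e2ennreal (- f 0 \<omega>) \<partial>M)"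
    by (intro nn_integral_mono e2ennreal_mono) (auto intro: SUP_upper)
  with fin have "(\<integral>\<^sup>+ \<omega>. e2ennreal (- (SUP n. f n \<omega>)) \<partial>M) \<noteq> top"
    by (auto simp: top_unique)
  then show ?thesis
    unfolding ereal_expectation_def
    by (intro tendsto_diff_ereal_general tendsto_enn2erealI pos neg) (auto simp: enn2ereal_nonneg)
qed

lemma SUP_ereal_eq_Max:
  fixes w :: "'i \<Rightarrow> real"
  assumes "finite J" "J \<noteq> {}"
  shows "(SUP i\<in>J. ereal (w i)) = ereal (Max (w ` J))"
proof -
  have "(SUP i\<in>J. ereal (w i)) = Max (ereal ` w ` J)"
    using assms by (simp add: Max_Sup image_image)
  also have "\<dots> = ereal (Max (w ` J))"
    using assms by (intro mono_Max_commute[symmetric] monoI) auto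
  finally show ?thesis .
qed

lemma ereal_expectation_SUP_finite:
  assumes X: "centered_gaussian_process M I X" and J: "finite J" "J \<noteq> {}" "J \<subseteq> I"
  shows "ereal_expectation M (\<lambda>\<omega>. SUP i\<in>J. ereal (X i \<omega> + m i))
      = ereal (\<integral>\<omega>. Max ((\<lambda>i. X i \<omega> + m i) ` J) \<partial>M)"
  using ereal_expectation_eq_integral[OF integrable_Max_process[OF centered_gaussian_process_subset[OF X J(3)] J(1,2), of m]]
  by (simp add: SUP_ereal_eq_Max[OF J(1,2), symmetric])

text \<open>The supremum over \<open>I\<close> is the increasing limit of the suprema over the
  \<open>J n\<close>. Nonemptiness of \<open>J 0\<close> gives the first of them a negative part of
  finite integral, as the convergence lemma demands.\<close>

lemma ereal_expectation_SUP_limit: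
  assumes X: "centered_gaussian_process M I X" and J: "\<And>n. finite (J n)" "\<And>n. J n \<noteq> {}" "incseq J" "(\<Union>n. J n) = I"
  shows "(\<lambda>n. ereal_expectation M (\<lambda>\<omega>. SUP i\<in>J n. ereal (X i \<omega> + m i)))
      \<longlonglongrightarrow> ereal_expectation M (\<lambda>\<omega>. SUP i\<in>I. ereal (X i \<omega> + m i))"
proof -
  have sub: "J n \<subseteq> I" for n using J(4) by auto
  have sup: "(SUP i\<in>I. ereal (X i \<omega> + m i)) = (SUP n. SUP i\<in>J n. ereal (X i \<omega> + m i))" for \<omega>
    unfolding J(4)[symmetric] by (rule SUP_UNION)
  show ?thesis
    unfolding sup
  proof (rule ereal_expectation_incseq)
    show "(\<lambda>\<omega>. SUP i\<in>J n. ereal (X i \<omega> + m i)) \<in> borel_measurable M" for n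
    proof (rule borel_measurable_SUP)
      fix i assume "i \<in> J n"
      then have "X i \<in> borel_measurable M"
        using sub[of n] centered_gaussian_process_component[OF X] by (auto simp: centered_gaussian_def)
      then show "(\<lambda>\<omega>. ereal (X i \<omega> + m i)) \<in> borel_measurable M" by measurable
    qed (use J(1) countable_finite in auto)
    show "incseq (\<lambda>n. SUP i\<in>J n. ereal (X i \<omega> + m i))" for \<omega>
      using J(3) by (auto simp: incseq_def intro!: SUP_subset_mono)
    show "(\<integral>\<^sup>+ \<omega>. e2ennreal (- (SUP i\<in>J 0. ereal (X i \<omega> + m i))) \<partial>M) < \<infinity>"
      by (rule sup_neg_part_finite[OF centered_gaussian_process_subset[OF X sub] J(2)])
  qed
qed

theorem mainTheorem1:
  fixes M :: "'a measure" and N :: "'b measure"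
    and I :: "'i set"
    and X :: "'i \<Rightarrow> 'a \<Rightarrow> real" and Y :: "'i \<Rightarrow> 'b \<Rightarrow> real"
    and m :: "'i \<Rightarrow> real"
  assumes "I \<noteq> {}" and "countable I"
    and "centered_gaussian_process M I X"
    and "centered_gaussian_process N I Y"
    and "\<And>i j. i \<in> I \<Longrightarrow> j \<in> I \<Longrightarrow>
           (\<integral>\<omega>. (X i \<omega> - X j \<omega>)\<^sup>2 \<partial>M) \<le> (\<integral>\<omega>. (Y i \<omega> - Y j \<omega>)\<^sup>2 \<partial>N)"
  shows "ereal_expectation M (\<lambda>\<omega>. SUP i\<in>I. ereal (X i \<omega> + m i))
       \<le> ereal_expectation N (\<lambda>\<omega>. SUP i\<in>I. ereal (Y i \<omega> + m i))"
proof -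
  \<comment> \<open>For finite \<open>I\<close> the enumeration \<open>from_nat_into I\<close>
    repeats elements but never leaves \<open>I\<close>, so finite and infinite index sets are
    exhausted in the same way, and \<open>{..n}\<close> makes every \<open>J n\<close>
    nonempty.\<close>
  define J where "J n = from_nat_into I ` {..n}" for n
  have J: "\<And>n. finite (J n)" "\<And>n. J n \<noteq> {}" "incseq J"
    by (auto simp: J_def incseq_def)
  have "(\<Union>n. J n) = range (from_nat_into I)"
    by (auto simp: J_def)
  then have UJ: "(\<Union>n. J n) = I"
    using assms(1,2) by (simp add: range_from_nat_into)
  then have sub: "J n \<subseteq> I" for n by auto
  have "ereal_expectation M (\<lambda>\<omega>. SUP i\<in>J n. ereal (X i \<omega> + m i))
      \<le> ereal_expectation N (\<lambda>\<omega>. SUP i\<in>J n. ereal (Y i \<omega> + m i))" for n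
  proof -
    have "(\<integral>\<omega>. Max ((\<lambda>i. X i \<omega> + m i) ` J n) \<partial>M) \<le> (\<integral>\<omega>. Max ((\<lambda>i. Y i \<omega> + m i) ` J n) \<partial>N)"
      using sub[of n] J(1,2)[of n]
      by (intro expectation_Max_comparison centered_gaussian_process_subset[OF assms(3)]
          centered_gaussian_process_subset[OF assms(4)] assms(5)) auto
    then show ?thesis
      by (simp add: ereal_expectation_SUP_finite[OF assms(3) J(1,2) sub] ereal_expectation_SUP_finite[OF assms(4) J(1,2) sub])
  qed
  then show ?thesis
    \<comment> \<open>The inequality holds for every \<open>J n\<close> and passes to the limit on
      both sides, including the case of infinite limits.\<close>
    by (intro LIMSEQ_le[OF ereal_expectation_SUP_limit[OF assms(3) J UJ] ereal_expectation_SUP_limit[OF assms(4) J UJ]])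
       auto
qed

end
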